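(* Let $\mathfrak F=(\mathcal V,\mathcal F,\imath)$ be a strict non-$\Sigma$ Feynman category such that $\mathcal F$ is decomposition finite. Let $\mathcal B=\mathbb Z[\mathrm{Mor}(\mathcal F)]$ with product $\mu(\phi,\psi)=\phi\otimes\psi$, unit $\eta(1)=id_{\mathbb 1}$, co-product $\Delta(\phi)=\sum_{(\phi_0,\phi_1):\,\phi=\phi_0\circ\phi_1}\phi_0\otimes\phi_1$, and co-unit $\epsilon$ with $\epsilon(\phi)=1$ if $\phi=id_X$ for some object $X$ and $\epsilon(\phi)=0$ for every other morphism $\phi$ (all extended $\mathbb Z$-linearly). Then $(\mathcal B,\otimes,\Delta,\epsilon,\eta)$ is a bi-algebra over $\mathbb Z$.
   Context: Comma categories: for functors $f:\mathcal F'\to\mathcal F$, $g:\mathcal F''\to\mathcal F$, the category $(f\downarrow g)$ has objects the triples $(X,Y,\phi:f(X)\to g(Y))$ and morphisms the pairs $(\psi:X\to X',\psi':Y\to Y')$ with $g(\psi')\circ\phi=\phi'\circ f(\psi)$. $Iso(\mathcal C)$ is the maximal subgroupoid of $\mathcal C$ (all objects, all isomorphisms). For a groupoid $\mathcal V$, $\mathcal V^\otimes$ denotes here the free monoidal category on $\mathcal V$; a functor $\imath:\mathcal V\to\mathcal F$ into a monoidal category extends to a monoidal functor $\imath^\otimes:\mathcal V^\otimes\to\mathcal F$. Write $(\mathcal F\downarrow\mathcal F)=(id_{\mathcal F}\downarrow id_{\mathcal F})$, $(\mathcal F\downarrow\mathcal V)=(id_{\mathcal F}\downarrow\imath)$.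 A non-$\Sigma$ Feynman category is a triple $(\mathcal V,\mathcal F,\imath)$, with $\mathcal V$ a groupoid, $(\mathcal F,\otimes,\mathbb 1)$ a monoidal category and $\imath:\mathcal V\to\mathcal F$ a functor, such that (i) $\imath^\otimes$ induces an equivalence of monoidal groupoids $\mathcal V^\otimes\simeq Iso(\mathcal F)$; (ii) $\imath$ and $\imath^\otimes$ induce (via $(\phi_v)_v\mapsto\bigotimes_v\phi_v$) an equivalence of monoidal groupoids $Iso(\mathcal F\downarrow\mathcal V)^\otimes\simeq Iso(\mathcal F\downarrow\mathcal F)$; (iii) for every object $*_v$ of $\mathcal V$ the category $(\mathcal F\downarrow *_v)$ is essentially small. It is strict if the monoidal structure on $\mathcal F$ is strict, $\imath$ is an inclusion, and $\mathcal V^\otimes=Iso(\mathcal F)$, using the strict free monoidal category. A category is decomposition finite if for every morphism $\phi$ the set of pairs $(\phi_0,\phi_1)$ with $\phi=\phi_0\circ\phi_1$ is finite. $\mathbb Z[\mathrm{Mor}(\mathcal F)]$ is the free Abelian group on the morphisms of $\mathcal F$. *)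

theory Defs
  imports "HOL-Algebra.Free_Abelian_Groups" "HOL-Algebra.Coset"
begin

section \<open>Categories and functors\<close>

record ('o, 'm) cat =
  Obj :: "'o set"
  Arr :: "'m set"
  src :: "'m \<Rightarrow> 'o"
  tgt :: "'m \<Rightarrow> 'o"
  ident :: "'o \<Rightarrow> 'm"
  cmp :: "'m \<Rightarrow> 'm \<Rightarrow> 'm"  (infixl "\<cdot>\<index>" 70)

text \<open>Composition is written in the order of function composition: \<open>g \<cdot> f\<close> is meaningful
  if \<open>src g = tgt f\<close>.\<close>

locale category =
  fixes C :: "('o, 'm, 'x) cat_scheme" (structure)
  assumes src_Obj: "f \<in> Arr C \<Longrightarrow> src C f \<in> Obj C"
    and tgt_Obj: "f \<in> Arr C \<Longrightarrow> tgt C f \<in> Obj C"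
    and ident_Arr: "X \<in> Obj C \<Longrightarrow> ident C X \<in> Arr C"
    and src_ident: "X \<in> Obj C \<Longrightarrow> src C (ident C X) = X"
    and tgt_ident: "X \<in> Obj C \<Longrightarrow> tgt C (ident C X) = X"
    and cmp_Arr: "\<lbrakk>f \<in> Arr C; g \<in> Arr C; src C g = tgt C f\<rbrakk> \<Longrightarrow> g \<cdot> f \<in> Arr C"
    and src_cmp: "\<lbrakk>f \<in> Arr C; g \<in> Arr C; src C g = tgt C f\<rbrakk> \<Longrightarrow> src C (g \<cdot> f) = src C f"
    and tgt_cmp: "\<lbrakk>f \<in> Arr C; g \<in> Arr C; src C g = tgt C f\<rbrakk> \<Longrightarrow> tgt C (g \<cdot> f) = tgt C g"
    and cmp_ident_left: "f \<in> Arr C \<Longrightarrow> ident C (tgt C f) \<cdot> f = f"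
    and cmp_ident_right: "f \<in> Arr C \<Longrightarrow> f \<cdot> ident C (src C f) = f"
    and cmp_assoc: "\<lbrakk>f \<in> Arr C; g \<in> Arr C; h \<in> Arr C; src C g = tgt C f; src C h = tgt C g\<rbrakk>
      \<Longrightarrow> (h \<cdot> g) \<cdot> f = h \<cdot> (g \<cdot> f)"

definition isomorphism :: "('o, 'm, 'x) cat_scheme \<Rightarrow> 'm \<Rightarrow> bool" where
  "isomorphism C f \<longleftrightarrow> f \<in> Arr C \<and>
     (\<exists>g \<in> Arr C. src C g = tgt C f \<and> tgt C g = src C f \<and>
        g \<cdot>\<^bsub>C\<^esub> f = ident C (src C f) \<and> f \<cdot>\<^bsub>C\<^esub> g = ident C (tgt C f))"

definition groupoid :: "('o, 'm, 'x) cat_scheme \<Rightarrow> bool" where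
  "groupoid C \<longleftrightarrow> category C \<and> (\<forall>f \<in> Arr C. isomorphism C f)"

text \<open>The maximal subgroupoid.  A record update, so that any monoidal structure is retained.\<close>

definition Iso_cat :: "('o, 'm, 'x) cat_scheme \<Rightarrow> ('o, 'm, 'x) cat_scheme" where
  "Iso_cat C = C\<lparr>Arr := {f. isomorphism C f}\<rparr>"

record ('o, 'm, 'p, 'n) fctr =
  omap :: "'o \<Rightarrow> 'p"
  amap :: "'m \<Rightarrow> 'n"

definition is_functor ::
    "('o, 'm, 'x) cat_scheme \<Rightarrow> ('p, 'n, 'y) cat_scheme \<Rightarrow> ('o, 'm, 'p, 'n) fctr \<Rightarrow> bool" where
  "is_functor C D f \<longleftrightarrow> category C \<and> category D \<and>
     (\<forall>X \<in> Obj C. omap f X \<in> Obj D \<and> amap f (ident C X) = ident D (omap f X)) \<and>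
     (\<forall>a \<in> Arr C. amap f a \<in> Arr D \<and> src D (amap f a) = omap f (src C a) \<and>
        tgt D (amap f a) = omap f (tgt C a)) \<and>
     (\<forall>a \<in> Arr C. \<forall>b \<in> Arr C. src C b = tgt C a \<longrightarrow>
        amap f (b \<cdot>\<^bsub>C\<^esub> a) = amap f b \<cdot>\<^bsub>D\<^esub> amap f a)"

definition id_fctr :: "('o, 'm, 'o, 'm) fctr" where
  "id_fctr = \<lparr>omap = (\<lambda>X. X), amap = (\<lambda>a. a)\<rparr>"

definition fctr_comp ::
    "('p, 'n, 'q, 'k) fctr \<Rightarrow> ('o, 'm, 'p, 'n) fctr \<Rightarrow> ('o, 'm, 'q, 'k) fctr" where
  "fctr_comp g f = \<lparr>omap = omap g \<circ> omap f, amap = amap g \<circ> amap f\<rparr>"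

definition natural_iso ::
    "('o, 'm, 'x) cat_scheme \<Rightarrow> ('p, 'n, 'y) cat_scheme \<Rightarrow>
     ('o, 'm, 'p, 'n) fctr \<Rightarrow> ('o, 'm, 'p, 'n) fctr \<Rightarrow> ('o \<Rightarrow> 'n) \<Rightarrow> bool" where
  "natural_iso C D f g \<tau> \<longleftrightarrow> is_functor C D f \<and> is_functor C D g \<and>
     (\<forall>X \<in> Obj C. isomorphism D (\<tau> X) \<and> src D (\<tau> X) = omap f X \<and> tgt D (\<tau> X) = omap g X) \<and>
     (\<forall>a \<in> Arr C. \<tau> (tgt C a) \<cdot>\<^bsub>D\<^esub> amap f a = amap g a \<cdot>\<^bsub>D\<^esub> \<tau> (src C a))"

definition cat_equivalence ::
    "('o, 'm, 'x) cat_scheme \<Rightarrow> ('p, 'n, 'y) cat_scheme \<Rightarrow> ('o, 'm, 'p, 'n) fctr \<Rightarrow> bool" where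
  "cat_equivalence C D f \<longleftrightarrow> is_functor C D f \<and>
     (\<exists>g \<sigma> \<tau>. is_functor D C g \<and> natural_iso C C id_fctr (fctr_comp g f) \<sigma> \<and>
        natural_iso D D (fctr_comp f g) id_fctr \<tau>)"

definition cat_isomorphism ::
    "('o, 'm, 'x) cat_scheme \<Rightarrow> ('p, 'n, 'y) cat_scheme \<Rightarrow> ('o, 'm, 'p, 'n) fctr \<Rightarrow> bool" where
  "cat_isomorphism C D f \<longleftrightarrow> is_functor C D f \<and>
     bij_betw (omap f) (Obj C) (Obj D) \<and> bij_betw (amap f) (Arr C) (Arr D)"

text \<open>HOL has no proper classes, so smallness is taken relative to a universe type \<open>'u\<close>: a small
  category is one whose objects and arrows are elements of \<open>'u\<close>.  Statements are to be
  polymorphic in \<open>'u\<close>.\<close>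

definition essentially_small :: "'u itself \<Rightarrow> ('o, 'm, 'x) cat_scheme \<Rightarrow> bool" where
  "essentially_small U C \<longleftrightarrow> (\<exists>(D :: ('u, 'u) cat) f. cat_equivalence C D f)"

section \<open>Comma categories\<close>

text \<open>For functors \<open>f\<close> from \<open>C\<close> and \<open>g\<close> from \<open>D\<close> to \<open>E\<close>.  An arrow carries its source and target
  triples besides the pair \<open>(\<psi>, \<psi>')\<close>.\<close>

type_synonym ('o, 'p, 'k) comma_obj = "'o \<times> 'p \<times> 'k"
type_synonym ('o, 'm, 'p, 'n, 'k) comma_arr =
  "('o, 'p, 'k) comma_obj \<times> ('o, 'p, 'k) comma_obj \<times> 'm \<times> 'n"

definition comma_objs ::
    "('o, 'm, 'x) cat_scheme \<Rightarrow> ('p, 'n, 'y) cat_scheme \<Rightarrow> ('q, 'k, 'z) cat_scheme \<Rightarrow>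
     ('o, 'm, 'q, 'k) fctr \<Rightarrow> ('p, 'n, 'q, 'k) fctr \<Rightarrow> ('o, 'p, 'k) comma_obj set" where
  "comma_objs C D E f g =
     {(X, Y, \<phi>). X \<in> Obj C \<and> Y \<in> Obj D \<and> \<phi> \<in> Arr E \<and> src E \<phi> = omap f X \<and> tgt E \<phi> = omap g Y}"

definition comma ::
    "('o, 'm, 'x) cat_scheme \<Rightarrow> ('p, 'n, 'y) cat_scheme \<Rightarrow> ('q, 'k, 'z) cat_scheme \<Rightarrow>
     ('o, 'm, 'q, 'k) fctr \<Rightarrow> ('p, 'n, 'q, 'k) fctr \<Rightarrow>
     (('o, 'p, 'k) comma_obj, ('o, 'm, 'p, 'n, 'k) comma_arr) cat" where
  "comma C D E f g =
     \<lparr>Obj = comma_objs C D E f g,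
      Arr = {((X, Y, \<phi>), (X', Y', \<phi>'), \<psi>, \<psi>').
               (X, Y, \<phi>) \<in> comma_objs C D E f g \<and> (X', Y', \<phi>') \<in> comma_objs C D E f g \<and>
               \<psi> \<in> Arr C \<and> src C \<psi> = X \<and> tgt C \<psi> = X' \<and>
               \<psi>' \<in> Arr D \<and> src D \<psi>' = Y \<and> tgt D \<psi>' = Y' \<and>
               amap g \<psi>' \<cdot>\<^bsub>E\<^esub> \<phi> = \<phi>' \<cdot>\<^bsub>E\<^esub> amap f \<psi>},
      src = (\<lambda>(S, T, \<psi>, \<psi>'). S),
      tgt = (\<lambda>(S, T, \<psi>, \<psi>'). T),
      ident = (\<lambda>(X, Y, \<phi>). ((X, Y, \<phi>), (X, Y, \<phi>), ident C X, ident D Y)),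
      cmp = (\<lambda>(S', T', \<chi>, \<chi>') (S, T, \<psi>, \<psi>'). (S, T', \<chi> \<cdot>\<^bsub>C\<^esub> \<psi>, \<chi>' \<cdot>\<^bsub>D\<^esub> \<psi>'))\<rparr>"

definition one_cat :: "(unit, unit) cat" where
  "one_cat = \<lparr>Obj = UNIV, Arr = UNIV, src = (\<lambda>_. ()), tgt = (\<lambda>_. ()), ident = (\<lambda>_. ()),
     cmp = (\<lambda>_ _. ())\<rparr>"

definition point_fctr :: "('o, 'm, 'x) cat_scheme \<Rightarrow> 'o \<Rightarrow> (unit, unit, 'o, 'm) fctr" where
  "point_fctr C X = \<lparr>omap = (\<lambda>_. X), amap = (\<lambda>_. ident C X)\<rparr>"

section \<open>Strict monoidal categories\<close>

record ('o, 'm) moncat = "('o, 'm) cat" +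
  tenO :: "'o \<Rightarrow> 'o \<Rightarrow> 'o"
  tenA :: "'m \<Rightarrow> 'm \<Rightarrow> 'm"
  unitO :: "'o"

locale strict_monoidal_category = category C
  for C :: "('o, 'm, 'x) moncat_scheme" (structure) +
  assumes unit_Obj: "unitO C \<in> Obj C"
    and tenO_Obj: "\<lbrakk>X \<in> Obj C; Y \<in> Obj C\<rbrakk> \<Longrightarrow> tenO C X Y \<in> Obj C"
    and tenA_Arr: "\<lbrakk>f \<in> Arr C; g \<in> Arr C\<rbrakk> \<Longrightarrow> tenA C f g \<in> Arr C"
    and src_tenA: "\<lbrakk>f \<in> Arr C; g \<in> Arr C\<rbrakk> \<Longrightarrow> src C (tenA C f g) = tenO C (src C f) (src C g)"
    and tgt_tenA: "\<lbrakk>f \<in> Arr C; g \<in> Arr C\<rbrakk> \<Longrightarrow> tgt C (tenA C f g) = tenO C (tgt C f) (tgt C g)"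
    and tenA_ident: "\<lbrakk>X \<in> Obj C; Y \<in> Obj C\<rbrakk>
      \<Longrightarrow> tenA C (ident C X) (ident C Y) = ident C (tenO C X Y)"
    and interchange: "\<lbrakk>f \<in> Arr C; g \<in> Arr C; f' \<in> Arr C; g' \<in> Arr C;
        src C g = tgt C f; src C g' = tgt C f'\<rbrakk>
      \<Longrightarrow> tenA C (g \<cdot> f) (g' \<cdot> f') = tenA C g g' \<cdot> tenA C f f'"
    and tenO_assoc: "\<lbrakk>X \<in> Obj C; Y \<in> Obj C; Z \<in> Obj C\<rbrakk>
      \<Longrightarrow> tenO C (tenO C X Y) Z = tenO C X (tenO C Y Z)"
    and tenA_assoc: "\<lbrakk>f \<in> Arr C; g \<in> Arr C; h \<in> Arr C\<rbrakk>
      \<Longrightarrow> tenA C (tenA C f g) h = tenA C f (tenA C g h)"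
    and tenO_unit_left: "X \<in> Obj C \<Longrightarrow> tenO C (unitO C) X = X"
    and tenO_unit_right: "X \<in> Obj C \<Longrightarrow> tenO C X (unitO C) = X"
    and tenA_unit_left: "f \<in> Arr C \<Longrightarrow> tenA C (ident C (unitO C)) f = f"
    and tenA_unit_right: "f \<in> Arr C \<Longrightarrow> tenA C f (ident C (unitO C)) = f"

definition strict_monoidal_functor ::
    "('o, 'm, 'x) moncat_scheme \<Rightarrow> ('p, 'n, 'y) moncat_scheme \<Rightarrow> ('o, 'm, 'p, 'n) fctr \<Rightarrow> bool" where
  "strict_monoidal_functor C D f \<longleftrightarrow>
     strict_monoidal_category C \<and> strict_monoidal_category D \<and> is_functor C D f \<and>
     omap f (unitO C) = unitO D \<and>
     (\<forall>X \<in> Obj C. \<forall>Y \<in> Obj C. omap f (tenO C X Y) = tenO D (omap f X) (omap f Y)) \<and>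
     (\<forall>a \<in> Arr C. \<forall>b \<in> Arr C. amap f (tenA C a b) = tenA D (amap f a) (amap f b))"

definition monoidal_equivalence ::
    "('o, 'm, 'x) moncat_scheme \<Rightarrow> ('p, 'n, 'y) moncat_scheme \<Rightarrow> ('o, 'm, 'p, 'n) fctr \<Rightarrow> bool" where
  "monoidal_equivalence C D f \<longleftrightarrow> strict_monoidal_functor C D f \<and> cat_equivalence C D f"

text \<open>The free strict monoidal category: words of objects, and letterwise words of arrows.\<close>

definition free_moncat :: "('o, 'm, 'x) cat_scheme \<Rightarrow> ('o list, 'm list) moncat" where
  "free_moncat C =
     \<lparr>Obj = lists (Obj C), Arr = lists (Arr C),
      src = map (src C), tgt = map (tgt C), ident = map (ident C), cmp = map2 (cmp C),
      tenO = (@), tenA = (@), unitO = []\<rparr>"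

text \<open>The extension of a functor into the strict monoidal category \<open>D\<close> to words.\<close>

definition free_ext ::
    "('p, 'n, 'y) moncat_scheme \<Rightarrow> ('o, 'm, 'p, 'n) fctr \<Rightarrow> ('o list, 'm list, 'p, 'n) fctr" where
  "free_ext D f =
     \<lparr>omap = (\<lambda>Xs. foldr (tenO D) (map (omap f) Xs) (unitO D)),
      amap = (\<lambda>as. foldr (tenA D) (map (amap f) as) (ident D (unitO D)))\<rparr>"

section \<open>Feynman categories\<close>

definition comma_FF :: "('o, 'm) moncat \<Rightarrow>
    (('o, 'o, 'm) comma_obj, ('o, 'm, 'o, 'm, 'm) comma_arr) moncat" where
  "comma_FF F = cat.extend (comma F F F id_fctr id_fctr)
     (moncat.fields
       (\<lambda>(X, Y, \<phi>) (X', Y', \<phi>'). (tenO F X X', tenO F Y Y', tenA F \<phi> \<phi>'))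
       (\<lambda>((X, Y, \<phi>), (Z, W, \<chi>), \<psi>, \<omega>) ((X', Y', \<phi>'), (Z', W', \<chi>'), \<psi>', \<omega>').
          ((tenO F X X', tenO F Y Y', tenA F \<phi> \<phi>'), (tenO F Z Z', tenO F W W', tenA F \<chi> \<chi>'),
           tenA F \<psi> \<psi>', tenA F \<omega> \<omega>'))
       (unitO F, unitO F, ident F (unitO F)))"

definition comma_FV :: "('v, 'w) cat \<Rightarrow> ('o, 'm) moncat \<Rightarrow> ('v, 'w, 'o, 'm) fctr \<Rightarrow>
    (('o, 'v, 'm) comma_obj, ('o, 'm, 'v, 'w, 'm) comma_arr) cat" where
  "comma_FV V F \<iota> = comma F V F id_fctr \<iota>"

text \<open>The functor from \<open>(F \<down> V)\<close> to \<open>(F \<down> F)\<close> induced by \<open>\<iota>\<close>.\<close>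

definition comma_incl :: "('v, 'w, 'o, 'm) fctr \<Rightarrow>
    (('o, 'v, 'm) comma_obj, ('o, 'm, 'v, 'w, 'm) comma_arr,
     ('o, 'o, 'm) comma_obj, ('o, 'm, 'o, 'm, 'm) comma_arr) fctr" where
  "comma_incl \<iota> =
     \<lparr>omap = (\<lambda>(X, v, \<phi>). (X, omap \<iota> v, \<phi>)),
      amap = (\<lambda>((X, v, \<phi>), (X', v', \<phi>'), \<psi>, \<psi>').
        ((X, omap \<iota> v, \<phi>), (X', omap \<iota> v', \<phi>'), \<psi>, amap \<iota> \<psi>'))\<rparr>"

text \<open>Only Feynman categories with strict underlying monoidal category are considered; the
  essential smallness condition is relative to the universe type \<open>'u\<close>.\<close>

definition nonsigma_feynman_category ::
    "'u itself \<Rightarrow> ('v, 'w) cat \<Rightarrow> ('o, 'm) moncat \<Rightarrow> ('v, 'w, 'o, 'm) fctr \<Rightarrow> bool" where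
  "nonsigma_feynman_category U V F \<iota> \<longleftrightarrow>
     groupoid V \<and> strict_monoidal_category F \<and> is_functor V F \<iota> \<and>
     monoidal_equivalence (free_moncat V) (Iso_cat F) (free_ext F \<iota>) \<and>
     monoidal_equivalence (free_moncat (Iso_cat (comma_FV V F \<iota>))) (Iso_cat (comma_FF F))
       (free_ext (comma_FF F) (comma_incl \<iota>)) \<and>
     (\<forall>v \<in> Obj V. essentially_small U
        (comma F one_cat F id_fctr (point_fctr F (omap \<iota> v))))"

text \<open>Words in \<open>V\<close> are identified with objects and arrows of \<open>F\<close> by evaluating them in \<open>F\<close>, so
  that the equality of the free monoidal category with \<open>Iso(F)\<close> says that this evaluation is an
  isomorphism of categories.\<close>

definition strict_nonsigma_feynman_category ::
    "'u itself \<Rightarrow> ('o, 'm) cat \<Rightarrow> ('o, 'm) moncat \<Rightarrow> ('o, 'm, 'o, 'm) fctr \<Rightarrow> bool" where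
  "strict_nonsigma_feynman_category U V F \<iota> \<longleftrightarrow>
     nonsigma_feynman_category U V F \<iota> \<and>
     (\<forall>X \<in> Obj V. omap \<iota> X = X) \<and> (\<forall>a \<in> Arr V. amap \<iota> a = a) \<and>
     cat_isomorphism (free_moncat V) (Iso_cat F) (free_ext F \<iota>)"

definition factorizations :: "('o, 'm, 'x) cat_scheme \<Rightarrow> 'm \<Rightarrow> ('m \<times> 'm) set" where
  "factorizations C \<phi> =
     {(\<phi>0, \<phi>1). \<phi>0 \<in> Arr C \<and> \<phi>1 \<in> Arr C \<and> src C \<phi>0 = tgt C \<phi>1 \<and> \<phi> = \<phi>0 \<cdot>\<^bsub>C\<^esub> \<phi>1}"

definition decomposition_finite :: "('o, 'm, 'x) cat_scheme \<Rightarrow> bool" where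
  "decomposition_finite C \<longleftrightarrow> (\<forall>\<phi> \<in> Arr C. finite (factorizations C \<phi>))"

section \<open>Tensor products of abelian groups\<close>

text \<open>Abelian groups are written multiplicatively, as in \<^term>\<open>free_Abelian_group\<close>;
  \<open>lin_ext C f\<close> is the additive extension of \<open>f\<close> to formal integral combinations.\<close>

definition lin_ext :: "('c, 'x) monoid_scheme \<Rightarrow> ('a \<Rightarrow> 'c) \<Rightarrow> ('a \<Rightarrow>\<^sub>0 int) \<Rightarrow> 'c" where
  "lin_ext C f x =
     (\<Otimes>\<^bsub>C\<^esub>a \<in> Poly_Mapping.keys x. f a [^]\<^bsub>C\<^esub> Poly_Mapping.lookup x a)"

definition tensor_relations ::
    "('a, 'x) monoid_scheme \<Rightarrow> ('b, 'y) monoid_scheme \<Rightarrow> ('a \<times> 'b \<Rightarrow>\<^sub>0 int) set" where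
  "tensor_relations A B =
     {frag_of (a \<otimes>\<^bsub>A\<^esub> a', b) - frag_of (a, b) - frag_of (a', b) | a a' b.
        a \<in> carrier A \<and> a' \<in> carrier A \<and> b \<in> carrier B} \<union>
     {frag_of (a, b \<otimes>\<^bsub>B\<^esub> b') - frag_of (a, b) - frag_of (a, b') | a b b'.
        a \<in> carrier A \<and> b \<in> carrier B \<and> b' \<in> carrier B}"

definition tensor_kernel ::
    "('a, 'x) monoid_scheme \<Rightarrow> ('b, 'y) monoid_scheme \<Rightarrow> ('a \<times> 'b \<Rightarrow>\<^sub>0 int) set" where
  "tensor_kernel A B =
     generate (free_Abelian_group (carrier A \<times> carrier B)) (tensor_relations A B)"

definition tensor ::
    "('a, 'x) monoid_scheme \<Rightarrow> ('b, 'y) monoid_scheme \<Rightarrow> ('a \<times> 'b \<Rightarrow>\<^sub>0 int) set monoid" where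
  "tensor A B = free_Abelian_group (carrier A \<times> carrier B) Mod tensor_kernel A B"

definition pure_tensor ::
    "('a, 'x) monoid_scheme \<Rightarrow> ('b, 'y) monoid_scheme \<Rightarrow> 'a \<Rightarrow> 'b \<Rightarrow> ('a \<times> 'b \<Rightarrow>\<^sub>0 int) set" where
  "pure_tensor A B a b =
     tensor_kernel A B #>\<^bsub>free_Abelian_group (carrier A \<times> carrier B)\<^esub> frag_of (a, b)"

text \<open>The homomorphism out of a tensor product induced by a biadditive map \<open>\<beta>\<close> into \<open>C\<close>: its
  additive extension to formal combinations of pairs is constant on cosets.\<close>

definition tensor_lift ::
    "('c, 'x) monoid_scheme \<Rightarrow> ('a \<Rightarrow> 'b \<Rightarrow> 'c) \<Rightarrow> ('a \<times> 'b \<Rightarrow>\<^sub>0 int) set \<Rightarrow> 'c" where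
  "tensor_lift C \<beta> T = the_elem (lin_ext C (\<lambda>(a, b). \<beta> a b) ` T)"

definition tensor_map ::
    "('c, 'x) monoid_scheme \<Rightarrow> ('d, 'y) monoid_scheme \<Rightarrow> ('a \<Rightarrow> 'c) \<Rightarrow> ('b \<Rightarrow> 'd) \<Rightarrow>
     ('a \<times> 'b \<Rightarrow>\<^sub>0 int) set \<Rightarrow> ('c \<times> 'd \<Rightarrow>\<^sub>0 int) set" where
  "tensor_map C D f g = tensor_lift (tensor C D) (\<lambda>a b. pure_tensor C D (f a) (g b))"

definition tensor_assoc ::
    "('a, 'x) monoid_scheme \<Rightarrow> ('b, 'y) monoid_scheme \<Rightarrow> ('c, 'z) monoid_scheme \<Rightarrow>
     (('a \<times> 'b \<Rightarrow>\<^sub>0 int) set \<times> 'c \<Rightarrow>\<^sub>0 int) set \<Rightarrow> ('a \<times> ('b \<times> 'c \<Rightarrow>\<^sub>0 int) set \<Rightarrow>\<^sub>0 int) set" where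
  "tensor_assoc A B C =
     tensor_lift (tensor A (tensor B C))
       (\<lambda>t c. tensor_lift (tensor A (tensor B C))
          (\<lambda>a b. pure_tensor A (tensor B C) a (pure_tensor B C b c)) t)"

text \<open>The product \<open>(a \<otimes> b)(c \<otimes> d) = ac \<otimes> bd\<close> induced by a product \<open>\<mu>\<close>.\<close>

definition tensor_mult ::
    "('a, 'x) monoid_scheme \<Rightarrow> ('a \<Rightarrow> 'a \<Rightarrow> 'a) \<Rightarrow>
     ('a \<times> 'a \<Rightarrow>\<^sub>0 int) set \<Rightarrow> ('a \<times> 'a \<Rightarrow>\<^sub>0 int) set \<Rightarrow> ('a \<times> 'a \<Rightarrow>\<^sub>0 int) set" where
  "tensor_mult B \<mu> s t =
     tensor_lift (tensor B B)
       (\<lambda>a b. tensor_lift (tensor B B) (\<lambda>c d. pure_tensor B B (\<mu> a c) (\<mu> b d)) t) s"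

section \<open>Bialgebras over the integers\<close>

locale int_algebra = comm_group B
  for B :: "('a, 'x) monoid_scheme" (structure) +
  fixes \<mu> :: "'a \<Rightarrow> 'a \<Rightarrow> 'a" and \<eta> :: "int \<Rightarrow> 'a"
  assumes mu_hom_left: "b \<in> carrier B \<Longrightarrow> (\<lambda>a. \<mu> a b) \<in> hom B B"
    and mu_hom_right: "a \<in> carrier B \<Longrightarrow> (\<lambda>b. \<mu> a b) \<in> hom B B"
    and mu_assoc: "\<lbrakk>a \<in> carrier B; b \<in> carrier B; c \<in> carrier B\<rbrakk> \<Longrightarrow> \<mu> (\<mu> a b) c = \<mu> a (\<mu> b c)"
    and eta_hom: "\<eta> \<in> hom integer_group B"
    and mu_unit_left: "a \<in> carrier B \<Longrightarrow> \<mu> (\<eta> 1) a = a"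
    and mu_unit_right: "a \<in> carrier B \<Longrightarrow> \<mu> a (\<eta> 1) = a"

text \<open>The counit laws use the canonical isomorphisms of \<open>B\<close> with \<open>\<int> \<otimes> B\<close> and \<open>B \<otimes> \<int>\<close>.\<close>

locale int_coalgebra = comm_group B
  for B :: "('a, 'x) monoid_scheme" (structure) +
  fixes \<Delta> :: "'a \<Rightarrow> ('a \<times> 'a \<Rightarrow>\<^sub>0 int) set" and \<epsilon> :: "'a \<Rightarrow> int"
  assumes Delta_hom: "\<Delta> \<in> hom B (tensor B B)"
    and eps_hom: "\<epsilon> \<in> hom B integer_group"
    and coassoc: "b \<in> carrier B \<Longrightarrow>
      tensor_assoc B B B (tensor_map (tensor B B) B \<Delta> (\<lambda>x. x) (\<Delta> b)) =
      tensor_map B (tensor B B) (\<lambda>x. x) \<Delta> (\<Delta> b)"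
    and counit_left: "b \<in> carrier B \<Longrightarrow>
      tensor_map integer_group B \<epsilon> (\<lambda>x. x) (\<Delta> b) = pure_tensor integer_group B 1 b"
    and counit_right: "b \<in> carrier B \<Longrightarrow>
      tensor_map B integer_group (\<lambda>x. x) \<epsilon> (\<Delta> b) = pure_tensor B integer_group b 1"

locale int_bialgebra = int_algebra B \<mu> \<eta> + int_coalgebra B \<Delta> \<epsilon>
  for B :: "('a, 'x) monoid_scheme" (structure) and \<mu> \<eta> \<Delta> \<epsilon> +
  assumes Delta_mu: "\<lbrakk>a \<in> carrier B; b \<in> carrier B\<rbrakk> \<Longrightarrow>
      \<Delta> (\<mu> a b) = tensor_mult B \<mu> (\<Delta> a) (\<Delta> b)"
    and Delta_unit: "\<Delta> (\<eta> 1) = pure_tensor B B (\<eta> 1) (\<eta> 1)"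
    and eps_mu: "\<lbrakk>a \<in> carrier B; b \<in> carrier B\<rbrakk> \<Longrightarrow> \<epsilon> (\<mu> a b) = \<epsilon> a * \<epsilon> b"
    and eps_unit: "\<epsilon> (\<eta> 1) = 1"

section \<open>The structure maps on the free abelian group on the morphisms\<close>

definition mor_group :: "('o, 'm) moncat \<Rightarrow> ('m \<Rightarrow>\<^sub>0 int) monoid" where
  "mor_group F = free_Abelian_group (Arr F)"

definition mor_mult :: "('o, 'm) moncat \<Rightarrow> ('m \<Rightarrow>\<^sub>0 int) \<Rightarrow> ('m \<Rightarrow>\<^sub>0 int) \<Rightarrow> ('m \<Rightarrow>\<^sub>0 int)" where
  "mor_mult F x y =
     lin_ext (mor_group F) (\<lambda>\<phi>. lin_ext (mor_group F) (\<lambda>\<psi>. frag_of (tenA F \<phi> \<psi>)) y) x"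

definition mor_unit :: "('o, 'm) moncat \<Rightarrow> int \<Rightarrow> ('m \<Rightarrow>\<^sub>0 int)" where
  "mor_unit F n = frag_of (ident F (unitO F)) [^]\<^bsub>mor_group F\<^esub> n"

definition mor_comult ::
    "('o, 'm) moncat \<Rightarrow> ('m \<Rightarrow>\<^sub>0 int) \<Rightarrow> (('m \<Rightarrow>\<^sub>0 int) \<times> ('m \<Rightarrow>\<^sub>0 int) \<Rightarrow>\<^sub>0 int) set" where
  "mor_comult F =
     lin_ext (tensor (mor_group F) (mor_group F))
       (\<lambda>\<phi>. \<Otimes>\<^bsub>tensor (mor_group F) (mor_group F)\<^esub>p \<in> factorizations F \<phi>.
          pure_tensor (mor_group F) (mor_group F) (frag_of (fst p)) (frag_of (snd p)))"

definition mor_counit :: "('o, 'm) moncat \<Rightarrow> ('m \<Rightarrow>\<^sub>0 int) \<Rightarrow> int" where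
  "mor_counit F =
     lin_ext integer_group (\<lambda>\<phi>. if \<exists>X \<in> Obj F. \<phi> = ident F X then 1 else 0)"

end

theory Submission
  imports Defs
begin

text \<open>The algebra axioms, coassociativity and the counit laws hold for the arrows of every
  decomposition finite strict monoidal category; coassociativity, for instance, compares two ways of
  listing the decompositions of an arrow into three (lemma \<open>factorizations_assoc\<close>).  What needs a
  Feynman category is the compatibility of product and coproduct: the factorizations of
  \<open>\<phi> \<otimes> \<psi>\<close> have to be the tensor products of a factorization of \<open>\<phi>\<close> and one of \<open>\<psi>\<close>, each obtained
  exactly once (lemma \<open>factorizations_tensor\<close>).

  This follows from a property of the tensor product that is isolated in the locale
  \<open>target_splitting_category\<close>: if the target of \<open>\<chi>\<close> is \<open>Y \<otimes> Y'\<close>, then \<open>\<chi> = \<alpha> \<otimes> \<beta>\<close> for unique \<open>\<alpha>\<close> with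
  target \<open>Y\<close> and \<open>\<beta>\<close> with target \<open>Y'\<close>.  Given \<open>\<phi> \<otimes> \<psi> = \<chi>\<^sub>0 \<circ> \<chi>\<^sub>1\<close>, first \<open>\<chi>\<^sub>0\<close> and then \<open>\<chi>\<^sub>1\<close> splits, and
  uniqueness forces the composites of the parts to be \<open>\<phi>\<close> and \<open>\<psi>\<close>.  The same property shows that
  \<open>\<phi> \<otimes> \<psi>\<close> is an identity only if \<open>\<phi>\<close> and \<open>\<psi>\<close> are, which makes the counit multiplicative, and that
  the unit arrow has only the trivial factorization, which makes the unit grouplike.

  A strict non-\<open>\<Sigma>\<close> Feynman category has this property because each of its arrows is a tensor product
  of arrows with target in \<open>V\<close>, for a unique word of such arrows (lemmas \<open>tensor_arrs_basic_surj\<close>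
  and \<open>tensor_arrs_basic_inj\<close>).  The equivalence of comma categories gives such a word up to
  isomorphism.  Isomorphisms of \<open>F\<close> are words of arrows of \<open>V\<close>, without permutations, so they split
  along the word and can be composed into its letters, and if they combine to an identity then each
  of them is one; hence existence and uniqueness hold strictly.  The word of an arrow has one letter
  for each letter of its target, which is why it can be cut according to \<open>Y \<otimes> Y'\<close>.

  The equations between maps on tensor products are checked on pure tensors of generators: a
  homomorphism out of a tensor product is determined there (lemma \<open>tensor_hom_eqI\<close>), and all maps in
  question are lifts of biadditive maps, with the expected values on pure tensors
  (lemma \<open>tensor_lift_pure\<close>).\<close>

section \<open>Homomorphisms of abelian groups\<close>

lemma hom_finprod:
  assumes G: "comm_group G" and H: "comm_group H" and h: "h \<in> hom G H"
    and f: "f \<in> A \<rightarrow> carrier G"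
  shows "h (finprod G f A) = finprod H (\<lambda>x. h (f x)) A"
proof -
  interpret G: comm_group G by (rule G)
  interpret H: comm_group H by (rule H)
  interpret h: group_hom G H h
    using h by (simp add: group_hom_def group_hom_axioms_def G.is_group H.is_group)
  show ?thesis using f
  proof (induction A rule: infinite_finite_induct)
    case (insert x F)
    then show ?case by (simp add: Pi_iff)
  qed auto
qed

lemma (in comm_monoid) finprod_Sigma:
  assumes "finite A" and "\<And>a. a \<in> A \<Longrightarrow> finite (B a)"
    and "\<And>a b. a \<in> A \<Longrightarrow> b \<in> B a \<Longrightarrow> f a b \<in> carrier G"
  shows "(\<Otimes>a\<in>A. \<Otimes>b\<in>B a. f a b) = (\<Otimes>p\<in>Sigma A B. f (fst p) (snd p))"
  using assms
proof (induction A)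
  case (insert x F)
  have "Sigma (insert x F) B = Pair x ` B x \<union> Sigma F B"
    by auto
  moreover have "(\<Otimes>p\<in>Pair x ` B x \<union> Sigma F B. f (fst p) (snd p))
      = (\<Otimes>p\<in>Pair x ` B x. f (fst p) (snd p)) \<otimes> (\<Otimes>p\<in>Sigma F B. f (fst p) (snd p))"
    using insert by (intro finprod_Un_disjoint) auto
  moreover have "(\<Otimes>p\<in>Pair x ` B x. f (fst p) (snd p)) = (\<Otimes>b\<in>B x. f x b)"
    using insert by (subst finprod_reindex) (auto simp: inj_on_def)
  ultimately show ?case
    using insert by (auto simp: Pi_iff)
qed auto

lemma hom_pointwise_mult:
  assumes "comm_group H" "h \<in> hom G H" "k \<in> hom G H"
  shows "(\<lambda>x. h x \<otimes>\<^bsub>H\<^esub> k x) \<in> hom G H"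
proof -
  interpret H: comm_group H by fact
  show ?thesis
    using assms(2,3) by (auto simp: hom_def Pi_iff H.m_ac)
qed

lemma hom_comp:
  assumes "h \<in> hom G H" "k \<in> hom H K"
  shows "(\<lambda>x. k (h x)) \<in> hom G K"
  using assms by (auto simp: hom_def Pi_iff)

text \<open>Associativity, coassociativity and the other laws with variables are equations between additive
  maps in each variable, so this lemma and its biadditive version reduce them to generators.\<close>

lemma free_Abelian_group_hom_eqI:
  assumes "group G" "h \<in> hom (free_Abelian_group S) G" "k \<in> hom (free_Abelian_group S) G"
    and "\<And>a. a \<in> S \<Longrightarrow> h (frag_of a) = k (frag_of a)"
    and "x \<in> carrier (free_Abelian_group S)"
  shows "h x = k x"
proof -
  interpret h: group_hom "free_Abelian_group S" G h
    using assms by (simp add: group_hom_def group_hom_axioms_def)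
  interpret k: group_hom "free_Abelian_group S" G k
    using assms by (simp add: group_hom_def group_hom_axioms_def)
  have "Poly_Mapping.keys x \<subseteq> S" using assms by simp
  then show ?thesis
  proof (induction x rule: free_Abelian_group_induct[consumes 1])
    case 1
    then show ?case using h.hom_one k.hom_one by simp
  next
    case (2 x y)
    have "h (x \<otimes>\<^bsub>free_Abelian_group S\<^esub> inv\<^bsub>free_Abelian_group S\<^esub> y)
        = k (x \<otimes>\<^bsub>free_Abelian_group S\<^esub> inv\<^bsub>free_Abelian_group S\<^esub> y)"
    proof -
      have "x \<in> carrier (free_Abelian_group S)" "y \<in> carrier (free_Abelian_group S)"
        using 2 by auto
      then show ?thesis
        using 2(3,4) by (simp del: mult_free_Abelian_group inv_free_Abelian_group
            carrier_free_Abelian_group_iff)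
    qed
    then show ?case using 2 by simp
  qed (use assms in auto)
qed

lemma lin_ext_hom:
  assumes "comm_group C" and f: "\<And>a. a \<in> S \<Longrightarrow> f a \<in> carrier C"
  shows "lin_ext C f \<in> hom (free_Abelian_group S) C"
proof -
  interpret C: comm_group C by fact
  have superset: "lin_ext C f x = (\<Otimes>\<^bsub>C\<^esub>a \<in> K. f a [^]\<^bsub>C\<^esub> Poly_Mapping.lookup x a)"
    if "finite K" "Poly_Mapping.keys x \<subseteq> K" "K \<subseteq> S" for x K
    unfolding lin_ext_def using that f
    by (intro C.finprod_mono_neutral_cong_left) (auto simp: in_keys_iff)
  show ?thesis
  proof (rule homI)
    fix x assume "x \<in> carrier (free_Abelian_group S)"
    then show "lin_ext C f x \<in> carrier C"
      using f by (auto simp: lin_ext_def intro!: C.finprod_closed)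
  next
    fix x y assume xy: "x \<in> carrier (free_Abelian_group S)" "y \<in> carrier (free_Abelian_group S)"
    let ?K = "Poly_Mapping.keys x \<union> Poly_Mapping.keys y"
    have K: "?K \<subseteq> S" using xy by auto
    have "lin_ext C f (x + y) = (\<Otimes>\<^bsub>C\<^esub>a \<in> ?K. f a [^]\<^bsub>C\<^esub> Poly_Mapping.lookup (x + y) a)"
      using K keys_add[of x y] by (intro superset) auto
    also have "\<dots> = (\<Otimes>\<^bsub>C\<^esub>a \<in> ?K. f a [^]\<^bsub>C\<^esub> Poly_Mapping.lookup x a \<otimes>\<^bsub>C\<^esub>
        f a [^]\<^bsub>C\<^esub> Poly_Mapping.lookup y a)"
      using K f by (intro C.finprod_cong') (auto simp: lookup_add C.int_pow_mult)
    also have "\<dots> = lin_ext C f x \<otimes>\<^bsub>C\<^esub> lin_ext C f y"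
      using K f by (subst C.finprod_multf) (auto simp: superset[of ?K])
    finally show "lin_ext C f (x \<otimes>\<^bsub>free_Abelian_group S\<^esub> y) = lin_ext C f x \<otimes>\<^bsub>C\<^esub> lin_ext C f y"
      by simp
  qed
qed

lemma lin_ext_frag_of:
  assumes "comm_group C" and "f a \<in> carrier C"
  shows "lin_ext C f (frag_of a) = f a"
proof -
  interpret C: comm_group C by fact
  show ?thesis
    using assms by (simp add: lin_ext_def)
qed

section \<open>The universal property of the tensor product\<close>

definition biadditive ::
    "('a, 'x) monoid_scheme \<Rightarrow> ('b, 'y) monoid_scheme \<Rightarrow> ('c, 'z) monoid_scheme \<Rightarrow>
     ('a \<Rightarrow> 'b \<Rightarrow> 'c) \<Rightarrow> bool" where
  "biadditive A B C \<beta> \<longleftrightarrow>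
     (\<forall>b \<in> carrier B. (\<lambda>a. \<beta> a b) \<in> hom A C) \<and> (\<forall>a \<in> carrier A. \<beta> a \<in> hom B C)"

lemma biadditiveI:
  assumes "\<And>b. b \<in> carrier B \<Longrightarrow> (\<lambda>a. \<beta> a b) \<in> hom A C"
    and "\<And>a. a \<in> carrier A \<Longrightarrow> (\<lambda>b. \<beta> a b) \<in> hom B C"
  shows "biadditive A B C \<beta>"
  using assms by (simp add: biadditive_def)

lemma biadditive_left: "biadditive A B C \<beta> \<Longrightarrow> b \<in> carrier B \<Longrightarrow> (\<lambda>a. \<beta> a b) \<in> hom A C"
  and biadditive_right: "biadditive A B C \<beta> \<Longrightarrow> a \<in> carrier A \<Longrightarrow> (\<lambda>b. \<beta> a b) \<in> hom B C"
  by (simp_all add: biadditive_def)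

lemma biadditive_closed:
  "biadditive A B C \<beta> \<Longrightarrow> a \<in> carrier A \<Longrightarrow> b \<in> carrier B \<Longrightarrow> \<beta> a b \<in> carrier C"
  by (auto simp: biadditive_def hom_def Pi_iff)

lemma biadditive_comp:
  assumes "biadditive C D E \<beta>" "f \<in> hom A C" "g \<in> hom B D"
  shows "biadditive A B E (\<lambda>a b. \<beta> (f a) (g b))"
proof (rule biadditiveI)
  show "(\<lambda>a. \<beta> (f a) (g b)) \<in> hom A E" if "b \<in> carrier B" for b
    by (rule hom_comp[OF assms(2) biadditive_left[OF assms(1) hom_in_carrier[OF assms(3) that]]])
  show "(\<lambda>b. \<beta> (f a) (g b)) \<in> hom B E" if "a \<in> carrier A" for a
    by (rule hom_comp[OF assms(3) biadditive_right[OF assms(1) hom_in_carrier[OF assms(2) that]]])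
qed

lemma biadditive_then_hom:
  assumes "biadditive A B C \<beta>" "h \<in> hom C D"
  shows "biadditive A B D (\<lambda>a b. h (\<beta> a b))"
  by (rule biadditiveI)
    (rule hom_comp[OF biadditive_left[OF assms(1)] assms(2)]
          hom_comp[OF biadditive_right[OF assms(1)] assms(2)]; assumption)+

lemma free_Abelian_group_biadditive_eqI:
  assumes D: "group D"
    and \<beta>: "biadditive (free_Abelian_group S) (free_Abelian_group T) D \<beta>"
    and \<gamma>: "biadditive (free_Abelian_group S) (free_Abelian_group T) D \<gamma>"
    and eq: "\<And>a b. a \<in> S \<Longrightarrow> b \<in> T \<Longrightarrow> \<beta> (frag_of a) (frag_of b) = \<gamma> (frag_of a) (frag_of b)"
    and x: "x \<in> carrier (free_Abelian_group S)" and y: "y \<in> carrier (free_Abelian_group T)"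
  shows "\<beta> x y = \<gamma> x y"
proof (rule free_Abelian_group_hom_eqI[OF D biadditive_left[OF \<beta> y] biadditive_left[OF \<gamma> y] _ x])
  fix a assume a: "a \<in> S"
  then have "frag_of a \<in> carrier (free_Abelian_group S)" by simp
  from free_Abelian_group_hom_eqI[OF D biadditive_right[OF \<beta> this] biadditive_right[OF \<gamma> this] _ y]
  show "\<beta> (frag_of a) y = \<gamma> (frag_of a) y"
    using eq a by blast
qed

lemma lin_ext_biadditive:
  assumes C: "comm_group C"
    and f: "\<And>a b. a \<in> S \<Longrightarrow> b \<in> T \<Longrightarrow> f a b \<in> carrier C"
  shows "biadditive (free_Abelian_group S) (free_Abelian_group T) C
           (\<lambda>x y. lin_ext C (\<lambda>a. lin_ext C (f a) y) x)"
    (is "biadditive ?S ?T C ?\<beta>")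
proof (rule biadditiveI)
  interpret C: comm_group C by (rule C)
  have inner: "lin_ext C (f a) \<in> hom ?T C" if "a \<in> S" for a
    using that f by (intro lin_ext_hom C) auto
  have inner_closed: "lin_ext C (f a) y \<in> carrier C" if "a \<in> S" "y \<in> carrier ?T" for a y
    using hom_in_carrier[OF inner] that by blast
  show left: "(\<lambda>x. ?\<beta> x y) \<in> hom ?S C" if "y \<in> carrier ?T" for y
    using inner_closed that by (intro lin_ext_hom C) auto
  show "(\<lambda>y. ?\<beta> x y) \<in> hom ?T C" if x: "x \<in> carrier ?S" for x
  proof (rule homI)
    show "?\<beta> x y \<in> carrier C" if "y \<in> carrier ?T" for y
      using hom_in_carrier[OF left x] that by blast
  next
    fix y z assume yz: "y \<in> carrier ?T" "z \<in> carrier ?T"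
    interpret T: group ?T by simp
    have yz': "y \<otimes>\<^bsub>?T\<^esub> z \<in> carrier ?T"
      using T.m_closed[OF yz] .
    \<comment> \<open>Both sides are additive in \<open>x\<close>, so only generators have to be compared.\<close>
    show "?\<beta> x (y \<otimes>\<^bsub>?T\<^esub> z) = ?\<beta> x y \<otimes>\<^bsub>C\<^esub> ?\<beta> x z"
    proof (rule free_Abelian_group_hom_eqI[OF C.is_group left[OF yz']
            hom_pointwise_mult[OF C left left] _ x])
      fix a assume a: "a \<in> S"
      then show "?\<beta> (frag_of a) (y \<otimes>\<^bsub>?T\<^esub> z) = ?\<beta> (frag_of a) y \<otimes>\<^bsub>C\<^esub> ?\<beta> (frag_of a) z"
        using hom_mult[OF inner[OF a] yz] inner_closed[OF a] yz yz'
        by (simp add: lin_ext_frag_of[OF C] del: mult_free_Abelian_group)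
    qed (use yz in auto)
  qed
qed

context
  fixes A :: "('a, 'x) monoid_scheme" and B :: "('b, 'y) monoid_scheme"
  assumes A: "comm_group A" and B: "comm_group B"
begin

interpretation A: comm_group A by (rule A)
interpretation B: comm_group B by (rule B)

private abbreviation "AB \<equiv> free_Abelian_group (carrier A \<times> carrier B)"
private abbreviation "K \<equiv> tensor_kernel A B"

interpretation AB: comm_group AB by (rule abelian_free_Abelian_group)

lemma tensor_relations_closed: "tensor_relations A B \<subseteq> carrier AB"
proof -
  have *: "frag_of p - frag_of q - frag_of r \<in> carrier AB"
    if "p \<in> carrier A \<times> carrier B" "q \<in> carrier A \<times> carrier B" "r \<in> carrier A \<times> carrier B" for p q r
  proof -
    have "Poly_Mapping.keys (frag_of p - frag_of q - frag_of r) \<subseteq> {p, q, r}"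
      using keys_diff[of "frag_of p - frag_of q" "frag_of r"] keys_diff[of "frag_of p" "frag_of q"]
      by auto
    then show ?thesis using that by auto
  qed
  show ?thesis
    unfolding tensor_relations_def by (auto simp del: carrier_free_Abelian_group_iff intro!: *)
qed

interpretation K: normal K AB
  using AB.subgroup_imp_normal[OF AB.generate_is_subgroup[OF tensor_relations_closed]]
  by (simp add: tensor_kernel_def)

lemma comm_group_tensor: "comm_group (tensor A B)"
  unfolding tensor_def by (rule AB.abelian_FactGroup[OF K.subgroup_axioms])

interpretation T: comm_group "tensor A B" by (rule comm_group_tensor)

lemma coset_hom_tensor: "(\<lambda>x. K #>\<^bsub>AB\<^esub> x) \<in> hom AB (tensor A B)"
  unfolding tensor_def by (rule K.r_coset_hom_Mod)

lemma tensor_carrierE: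
  assumes "t \<in> carrier (tensor A B)"
  obtains x where "x \<in> carrier AB" "t = K #>\<^bsub>AB\<^esub> x"
  using assms by (auto simp: tensor_def carrier_FactGroup)

text \<open>The elements of \<^const>\<open>tensor_relations\<close> are the failures of biadditivity, and their cosets are
  trivial.\<close>

lemma pure_tensor_biadditive: "biadditive A B (tensor A B) (pure_tensor A B)"
proof -
  have closed: "pure_tensor A B a b \<in> carrier (tensor A B)"
    if "a \<in> carrier A" "b \<in> carrier B" for a b
    using that unfolding pure_tensor_def by (intro hom_in_carrier[OF coset_hom_tensor]) auto
  have relation: "K #>\<^bsub>AB\<^esub> frag_of p = (K #>\<^bsub>AB\<^esub> frag_of q) \<otimes>\<^bsub>tensor A B\<^esub> (K #>\<^bsub>AB\<^esub> frag_of r)"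
    if rel: "frag_of p - frag_of q - frag_of r \<in> tensor_relations A B"
      and qr: "q \<in> carrier A \<times> carrier B" "r \<in> carrier A \<times> carrier B" for p q r
  proof -
    let ?d = "frag_of p - frag_of q - frag_of r"
    have d: "?d \<in> K" "?d \<in> carrier AB"
      using generate.incl[OF rel] subsetD[OF tensor_relations_closed rel]
      by (simp_all add: tensor_kernel_def del: carrier_free_Abelian_group_iff)
    have qr': "frag_of q \<in> carrier AB" "frag_of r \<in> carrier AB"
      using qr by auto
    have "K #>\<^bsub>AB\<^esub> frag_of p = K #>\<^bsub>AB\<^esub> (?d \<otimes>\<^bsub>AB\<^esub> (frag_of q \<otimes>\<^bsub>AB\<^esub> frag_of r))"
      by simp
    also have "\<dots> = (K #>\<^bsub>AB\<^esub> ?d) \<otimes>\<^bsub>tensor A B\<^esub>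
        ((K #>\<^bsub>AB\<^esub> frag_of q) \<otimes>\<^bsub>tensor A B\<^esub> (K #>\<^bsub>AB\<^esub> frag_of r))"
      using d qr' AB.m_closed
      by (simp only: hom_mult[OF coset_hom_tensor])
    also have "K #>\<^bsub>AB\<^esub> ?d = \<one>\<^bsub>tensor A B\<^esub>"
      using AB.coset_join2[OF d(2) K.subgroup_axioms d(1)] by (simp add: tensor_def)
    finally show ?thesis
      using hom_in_carrier[OF coset_hom_tensor] qr' by (simp del: carrier_free_Abelian_group_iff)
  qed
  show ?thesis
  proof (intro biadditiveI homI)
    fix a a' b assume "a \<in> carrier A" "a' \<in> carrier A" "b \<in> carrier B"
    then show "pure_tensor A B (a \<otimes>\<^bsub>A\<^esub> a') b
        = pure_tensor A B a b \<otimes>\<^bsub>tensor A B\<^esub> pure_tensor A B a' b"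
      unfolding pure_tensor_def
      by (intro relation) (unfold tensor_relations_def, blast+)
  next
    fix a b b' assume "a \<in> carrier A" "b \<in> carrier B" "b' \<in> carrier B"
    then show "pure_tensor A B a (b \<otimes>\<^bsub>B\<^esub> b')
        = pure_tensor A B a b \<otimes>\<^bsub>tensor A B\<^esub> pure_tensor A B a b'"
      unfolding pure_tensor_def
      by (intro relation) (unfold tensor_relations_def, blast+)
  qed (use closed in auto)
qed

text \<open>Pure tensors generate the tensor product, being the cosets of the generators of the free
  abelian group on pairs.\<close>

lemma tensor_hom_eqI:
  assumes "group D" "h \<in> hom (tensor A B) D" "k \<in> hom (tensor A B) D"
    and "\<And>a b. a \<in> carrier A \<Longrightarrow> b \<in> carrier B \<Longrightarrow>
      h (pure_tensor A B a b) = k (pure_tensor A B a b)"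
    and t: "t \<in> carrier (tensor A B)"
  shows "h t = k t"
proof -
  obtain x where x: "x \<in> carrier AB" "t = K #>\<^bsub>AB\<^esub> x"
    using t by (rule tensor_carrierE)
  have "h (K #>\<^bsub>AB\<^esub> x) = k (K #>\<^bsub>AB\<^esub> x)"
  proof (rule free_Abelian_group_hom_eqI[OF \<open>group D\<close> hom_comp[OF coset_hom_tensor assms(2)]
          hom_comp[OF coset_hom_tensor assms(3)] _ x(1)])
    fix p assume "p \<in> carrier A \<times> carrier B"
    then show "h (K #>\<^bsub>AB\<^esub> frag_of p) = k (K #>\<^bsub>AB\<^esub> frag_of p)"
      using assms(4)[of "fst p" "snd p"] by (auto simp: pure_tensor_def)
  qed
  with x show ?thesis by simp
qed

text \<open>The additive extension of a biadditive map kills the relations, so it is constant on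
  each coset and the value chosen by \<^const>\<open>tensor_lift\<close> is that of any representative.\<close>

lemma tensor_lift_coset:
  assumes C: "comm_group C" and \<beta>: "biadditive A B C \<beta>" and x: "x \<in> carrier AB"
  shows "tensor_lift C \<beta> (K #>\<^bsub>AB\<^esub> x) = lin_ext C (\<lambda>(a, b). \<beta> a b) x"
proof -
  interpret C: comm_group C by (rule C)
  let ?h = "lin_ext C (\<lambda>(a, b). \<beta> a b)"
  have h: "?h \<in> hom AB C"
    using biadditive_closed[OF \<beta>] by (intro lin_ext_hom C) auto
  have frag: "?h (frag_of (a, b)) = \<beta> a b" if "a \<in> carrier A" "b \<in> carrier B" for a b
    using biadditive_closed[OF \<beta> that] by (simp add: lin_ext_frag_of[OF C])
  interpret h: group_hom AB C ?h
    using h by (simp add: group_hom_def group_hom_axioms_def C.is_group)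
  have kills: "?h (frag_of p - frag_of q - frag_of r) = \<one>\<^bsub>C\<^esub>"
    if "?h (frag_of p) = ?h (frag_of q) \<otimes>\<^bsub>C\<^esub> ?h (frag_of r)"
      and pqr: "p \<in> carrier A \<times> carrier B" "q \<in> carrier A \<times> carrier B" "r \<in> carrier A \<times> carrier B" for p q r
  proof -
    have c: "frag_of p \<in> carrier AB" "frag_of q \<in> carrier AB" "frag_of r \<in> carrier AB"
      using pqr by auto
    have "frag_of p - frag_of q - frag_of r
        = frag_of p \<otimes>\<^bsub>AB\<^esub> inv\<^bsub>AB\<^esub> (frag_of q \<otimes>\<^bsub>AB\<^esub> frag_of r)"
      using AB.m_closed[OF c(2,3)] by simp
    then show ?thesis
      using c that(1) h.hom_closed AB.m_closed AB.inv_closed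
      by (simp del: mult_free_Abelian_group inv_free_Abelian_group carrier_free_Abelian_group_iff)
  qed
  have "tensor_relations A B \<subseteq> kernel AB C ?h"
  proof
    fix r assume r: "r \<in> tensor_relations A B"
    have "?h r = \<one>\<^bsub>C\<^esub>"
      using r unfolding tensor_relations_def
    proof (elim UnE CollectE exE conjE)
      fix a a' b assume "r = frag_of (a \<otimes>\<^bsub>A\<^esub> a', b) - frag_of (a, b) - frag_of (a', b)"
        and "a \<in> carrier A" "a' \<in> carrier A" "b \<in> carrier B"
      then show ?thesis
        using hom_mult[OF biadditive_left[OF \<beta>]] by (auto intro!: kills simp: frag)
    next
      fix a b b' assume "r = frag_of (a, b \<otimes>\<^bsub>B\<^esub> b') - frag_of (a, b) - frag_of (a, b')"
        and "a \<in> carrier A" "b \<in> carrier B" "b' \<in> carrier B"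
      then show ?thesis
        using hom_mult[OF biadditive_right[OF \<beta>]] by (auto intro!: kills simp: frag)
    qed
    then show "r \<in> kernel AB C ?h"
      using subsetD[OF tensor_relations_closed r] by (simp add: kernel_def)
  qed
  then have K_kernel: "K \<subseteq> kernel AB C ?h"
    unfolding tensor_kernel_def by (intro AB.generate_subgroup_incl h.subgroup_kernel)
  have "?h ` (K #>\<^bsub>AB\<^esub> x) = {?h x}"
  proof -
    have "?h (k \<otimes>\<^bsub>AB\<^esub> x) = ?h x" if "k \<in> K" for k
    proof -
      have k: "k \<in> carrier AB" "?h k = \<one>\<^bsub>C\<^esub>"
        using K_kernel that by (auto simp: kernel_def)
      show ?thesis
        using h.hom_mult[OF k(1) x] k(2) h.hom_closed[OF x] by simp
    qed
    then have "(\<lambda>k. ?h (k \<otimes>\<^bsub>AB\<^esub> x)) ` K = (\<lambda>k. ?h x) ` K"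
      by (rule image_cong[OF refl])
    moreover have "?h ` (K #>\<^bsub>AB\<^esub> x) = (\<lambda>k. ?h (k \<otimes>\<^bsub>AB\<^esub> x)) ` K"
      by (auto simp: r_coset_def)
    moreover have "K \<noteq> {}" using K.one_closed by blast
    ultimately show ?thesis by auto
  qed
  then show ?thesis by (simp add: tensor_lift_def)
qed

lemma tensor_lift_hom:
  assumes C: "comm_group C" and \<beta>: "biadditive A B C \<beta>"
  shows "tensor_lift C \<beta> \<in> hom (tensor A B) C"
proof -
  let ?h = "lin_ext C (\<lambda>(a, b). \<beta> a b)"
  have h: "?h \<in> hom AB C"
    using biadditive_closed[OF \<beta>] by (intro lin_ext_hom C) auto
  show ?thesis
  proof (rule homI)
    fix t assume "t \<in> carrier (tensor A B)"
    then obtain x where "x \<in> carrier AB" "t = K #>\<^bsub>AB\<^esub> x"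
      by (rule tensor_carrierE)
    then show "tensor_lift C \<beta> t \<in> carrier C"
      using tensor_lift_coset[OF C \<beta>] hom_in_carrier[OF h] by (simp only:)
  next
    fix s t assume "s \<in> carrier (tensor A B)" "t \<in> carrier (tensor A B)"
    then obtain x y where xy: "x \<in> carrier AB" "s = K #>\<^bsub>AB\<^esub> x" "y \<in> carrier AB" "t = K #>\<^bsub>AB\<^esub> y"
      by (metis tensor_carrierE)
    then have "s \<otimes>\<^bsub>tensor A B\<^esub> t = K #>\<^bsub>AB\<^esub> (x \<otimes>\<^bsub>AB\<^esub> y)"
      using hom_mult[OF coset_hom_tensor] by (simp only:)
    then show "tensor_lift C \<beta> (s \<otimes>\<^bsub>tensor A B\<^esub> t) = tensor_lift C \<beta> s \<otimes>\<^bsub>C\<^esub> tensor_lift C \<beta> t"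
      using tensor_lift_coset[OF C \<beta>] hom_mult[OF h] xy AB.m_closed by (simp only:)
  qed
qed

lemma tensor_lift_pure:
  assumes C: "comm_group C" and \<beta>: "biadditive A B C \<beta>"
    and "a \<in> carrier A" "b \<in> carrier B"
  shows "tensor_lift C \<beta> (pure_tensor A B a b) = \<beta> a b"
  using assms tensor_lift_coset[OF C \<beta>, of "frag_of (a, b)"] biadditive_closed[OF \<beta>]
  by (simp add: pure_tensor_def lin_ext_frag_of[OF C])

end

lemma hom_ident: "(\<lambda>x. x) \<in> hom A A"
  by (auto simp: hom_def)

text \<open>Iterated lifts, as they occur in \<^const>\<open>tensor_assoc\<close> and \<^const>\<open>tensor_mult\<close>, are again
  biadditive; additivity in the parameter \<open>c\<close> is inherited from the values on pure tensors.\<close>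

lemma tensor_lift_biadditive:
  assumes A: "comm_group A" and B: "comm_group B" and C: "comm_group C" and D: "comm_group D"
    and \<gamma>: "\<And>c. c \<in> carrier C \<Longrightarrow> biadditive A B D (\<lambda>a b. \<gamma> a b c)"
    and \<gamma>_hom: "\<And>a b. a \<in> carrier A \<Longrightarrow> b \<in> carrier B \<Longrightarrow> \<gamma> a b \<in> hom C D"
  shows "biadditive (tensor A B) C D (\<lambda>t c. tensor_lift D (\<lambda>a b. \<gamma> a b c) t)"
    (is "biadditive _ _ _ ?L")
proof (rule biadditiveI)
  interpret C: comm_group C by (rule C)
  interpret D: comm_group D by (rule D)
  show left: "(\<lambda>t. ?L t c) \<in> hom (tensor A B) D" if "c \<in> carrier C" for c
    using tensor_lift_hom[OF A B D \<gamma>[OF that]] .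
  show "(\<lambda>c. ?L t c) \<in> hom C D" if t: "t \<in> carrier (tensor A B)" for t
  proof (rule homI)
    show "?L t c \<in> carrier D" if "c \<in> carrier C" for c
      using hom_in_carrier[OF left[OF that] t] .
  next
    fix c d assume c: "c \<in> carrier C" and d: "d \<in> carrier C"
    show "?L t (c \<otimes>\<^bsub>C\<^esub> d) = ?L t c \<otimes>\<^bsub>D\<^esub> ?L t d"
    proof (rule tensor_hom_eqI[OF A B D.is_group left[OF C.m_closed[OF c d]]
            hom_pointwise_mult[OF D left[OF c] left[OF d]] _ t])
      fix a b assume ab: "a \<in> carrier A" "b \<in> carrier B"
      show "?L (pure_tensor A B a b) (c \<otimes>\<^bsub>C\<^esub> d)
          = ?L (pure_tensor A B a b) c \<otimes>\<^bsub>D\<^esub> ?L (pure_tensor A B a b) d"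
        using hom_mult[OF \<gamma>_hom[OF ab] c d]
        by (simp only: tensor_lift_pure[OF A B D \<gamma> ab] c d C.m_closed)
    qed
  qed
qed

lemma
  assumes A: "comm_group A" and B: "comm_group B" and C: "comm_group C" and D: "comm_group D"
    and f: "f \<in> hom A C" and g: "g \<in> hom B D"
  shows tensor_map_hom: "tensor_map C D f g \<in> hom (tensor A B) (tensor C D)"
    and tensor_map_pure: "\<And>a b. a \<in> carrier A \<Longrightarrow> b \<in> carrier B \<Longrightarrow>
      tensor_map C D f g (pure_tensor A B a b) = pure_tensor C D (f a) (g b)"
proof -
  note b = biadditive_comp[OF pure_tensor_biadditive[OF C D] f g]
  show "tensor_map C D f g \<in> hom (tensor A B) (tensor C D)"
    unfolding tensor_map_def by (rule tensor_lift_hom[OF A B comm_group_tensor[OF C D] b])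
  show "tensor_map C D f g (pure_tensor A B x y) = pure_tensor C D (f x) (g y)"
    if "x \<in> carrier A" "y \<in> carrier B" for x y
    unfolding tensor_map_def
    by (rule tensor_lift_pure[OF A B comm_group_tensor[OF C D] b that])
qed

lemma
  assumes A: "comm_group A" and B: "comm_group B" and C: "comm_group C"
  shows tensor_assoc_hom:
      "tensor_assoc A B C \<in> hom (tensor (tensor A B) C) (tensor A (tensor B C))"
    and tensor_assoc_pure: "\<And>a b c. a \<in> carrier A \<Longrightarrow> b \<in> carrier B \<Longrightarrow> c \<in> carrier C \<Longrightarrow>
      tensor_assoc A B C (pure_tensor (tensor A B) C (pure_tensor A B a b) c)
        = pure_tensor A (tensor B C) a (pure_tensor B C b c)"
proof -
  note AB = comm_group_tensor[OF A B] and BC = comm_group_tensor[OF B C]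
  note T = comm_group_tensor[OF A BC]
  note pure = pure_tensor_biadditive
  have biadd: "biadditive A B (tensor A (tensor B C))
      (\<lambda>a b. pure_tensor A (tensor B C) a (pure_tensor B C b c))" if "c \<in> carrier C" for c
    by (rule biadditive_comp[OF pure[OF A BC] hom_ident biadditive_left[OF pure[OF B C] that]])
  have hom: "(\<lambda>c. pure_tensor A (tensor B C) a (pure_tensor B C b c)) \<in> hom C (tensor A (tensor B C))"
    if "a \<in> carrier A" "b \<in> carrier B" for a b
    by (rule hom_comp[OF biadditive_right[OF pure[OF B C] that(2)]
          biadditive_right[OF pure[OF A BC] that(1)]])
  note lift = tensor_lift_biadditive[OF A B C T biadd hom]
  show "tensor_assoc A B C \<in> hom (tensor (tensor A B) C) (tensor A (tensor B C))"
    unfolding tensor_assoc_def by (rule tensor_lift_hom[OF AB C T lift])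
  show "tensor_assoc A B C (pure_tensor (tensor A B) C (pure_tensor A B x y) z)
      = pure_tensor A (tensor B C) x (pure_tensor B C y z)"
    if "x \<in> carrier A" "y \<in> carrier B" "z \<in> carrier C" for x y z
    using tensor_lift_pure[OF AB C T lift biadditive_closed[OF pure[OF A B] that(1,2)] that(3)]
      tensor_lift_pure[OF A B T biadd[OF that(3)] that(1,2)]
    by (simp add: tensor_assoc_def)
qed

lemma
  assumes B: "comm_group B" and \<mu>: "biadditive B B B \<mu>"
  shows tensor_mult_biadditive:
      "biadditive (tensor B B) (tensor B B) (tensor B B) (tensor_mult B \<mu>)"
    and tensor_mult_pure: "\<And>a b c d. a \<in> carrier B \<Longrightarrow> b \<in> carrier B \<Longrightarrow> c \<in> carrier B \<Longrightarrow>
      d \<in> carrier B \<Longrightarrow> tensor_mult B \<mu> (pure_tensor B B a b) (pure_tensor B B c d)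
        = pure_tensor B B (\<mu> a c) (\<mu> b d)"
proof -
  note T = comm_group_tensor[OF B B]
  note pure = pure_tensor_biadditive[OF B B]
  let ?\<gamma> = "\<lambda>a b c d. pure_tensor B B (\<mu> a c) (\<mu> b d)"
  have cd: "biadditive B B (tensor B B) (?\<gamma> a b)" if "a \<in> carrier B" "b \<in> carrier B" for a b
    by (rule biadditive_comp[OF pure biadditive_right[OF \<mu> that(1)] biadditive_right[OF \<mu> that(2)]])
  have ab: "biadditive B B (tensor B B) (\<lambda>a b. ?\<gamma> a b c d)" if "c \<in> carrier B" "d \<in> carrier B" for c d
    by (rule biadditive_comp[OF pure biadditive_left[OF \<mu> that(1)] biadditive_left[OF \<mu> that(2)]])
  have lift_ab: "biadditive B B (tensor B B) (\<lambda>a b. tensor_lift (tensor B B) (?\<gamma> a b) t)"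
    if t: "t \<in> carrier (tensor B B)" for t
  proof (rule biadditiveI)
    show "(\<lambda>a. tensor_lift (tensor B B) (?\<gamma> a b) t) \<in> hom B (tensor B B)" if b: "b \<in> carrier B" for b
      by (rule biadditive_right[OF tensor_lift_biadditive[OF B B B T cd[OF _ b]
              biadditive_left[OF ab b]] t])
    show "(\<lambda>b. tensor_lift (tensor B B) (?\<gamma> a b) t) \<in> hom B (tensor B B)" if a: "a \<in> carrier B" for a
      by (rule biadditive_right[OF tensor_lift_biadditive[OF B B B T cd[OF a]
              biadditive_right[OF ab a]] t])
  qed
  note inner = tensor_lift_hom[OF B B T cd]
  show "biadditive (tensor B B) (tensor B B) (tensor B B) (tensor_mult B \<mu>)"
    unfolding tensor_mult_def by (rule tensor_lift_biadditive[OF B B T T lift_ab inner])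
  show "tensor_mult B \<mu> (pure_tensor B B w x) (pure_tensor B B y z) = ?\<gamma> w x y z"
    if wx: "w \<in> carrier B" "x \<in> carrier B" and yz: "y \<in> carrier B" "z \<in> carrier B" for w x y z
    using tensor_lift_pure[OF B B T lift_ab[OF biadditive_closed[OF pure yz]] wx]
      tensor_lift_pure[OF B B T cd[OF wx] yz]
    by (simp add: tensor_mult_def)
qed

section \<open>Equivalences of categories and maximal subgroupoids\<close>

lemma Iso_cat_sel [simp]:
  "Obj (Iso_cat C) = Obj C" "Arr (Iso_cat C) = {f. isomorphism C f}" "src (Iso_cat C) = src C"
  "tgt (Iso_cat C) = tgt C" "ident (Iso_cat C) = ident C" "cmp (Iso_cat C) = cmp C"
  by (simp_all add: Iso_cat_def)

lemma isomorphism_Iso_cat: "isomorphism (Iso_cat C) f \<Longrightarrow> isomorphism C f"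
  by (auto simp: isomorphism_def)

lemma isomorphism_Arr: "isomorphism C f \<Longrightarrow> f \<in> Arr C"
  by (simp add: isomorphism_def)

lemma (in category) isomorphism_inverse:
  assumes "isomorphism C f"
  obtains g where "isomorphism C g" "src C g = tgt C f" "tgt C g = src C f"
    "g \<cdot> f = ident C (src C f)" "f \<cdot> g = ident C (tgt C f)"
  using assms unfolding isomorphism_def by metis

lemma cat_equivalence_essentially_surjective:
  assumes "cat_equivalence C D f" "Y \<in> Obj D"
  obtains X h where "X \<in> Obj C" "isomorphism D h" "src D h = omap f X" "tgt D h = Y"
proof -
  obtain g \<tau> where "is_functor D C g" and "natural_iso D D (fctr_comp f g) id_fctr \<tau>"
    using assms(1) unfolding cat_equivalence_def by blast
  then have "omap g Y \<in> Obj C" "isomorphism D (\<tau> Y)" "src D (\<tau> Y) = omap f (omap g Y)"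
    "tgt D (\<tau> Y) = Y"
    using assms(2) by (auto simp: natural_iso_def is_functor_def fctr_comp_def id_fctr_def)
  then show thesis by (rule that)
qed

text \<open>A quasi-inverse \<open>g\<close> is faithful because \<open>\<tau>\<close> is natural, and \<open>g\<close> cannot distinguish \<open>h\<close> from the
  image of its transport along \<open>\<sigma>\<close>.\<close>

lemma cat_equivalence_full:
  assumes eqv: "cat_equivalence C D f" and A: "A \<in> Obj C" and B: "B \<in> Obj C"
    and h: "h \<in> Arr D" "src D h = omap f A" "tgt D h = omap f B"
  obtains k where "k \<in> Arr C" "src C k = A" "tgt C k = B" "amap f k = h"
proof -
  obtain g \<sigma> \<tau> where f: "is_functor C D f" and g: "is_functor D C g"
    and \<sigma>: "natural_iso C C id_fctr (fctr_comp g f) \<sigma>"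
    and \<tau>: "natural_iso D D (fctr_comp f g) id_fctr \<tau>"
    using eqv unfolding cat_equivalence_def by blast
  interpret C: category C using f by (simp add: is_functor_def)
  interpret D: category D using f by (simp add: is_functor_def)
  have f_Arr: "amap f a \<in> Arr D" "src D (amap f a) = omap f (src C a)"
    "tgt D (amap f a) = omap f (tgt C a)" if "a \<in> Arr C" for a
    using f that by (auto simp: is_functor_def)
  have g_Arr: "amap g a \<in> Arr C" "src C (amap g a) = omap g (src D a)"
    "tgt C (amap g a) = omap g (tgt D a)" if "a \<in> Arr D" for a
    using g that by (auto simp: is_functor_def)
  have \<sigma>_iso: "isomorphism C (\<sigma> X)" "src C (\<sigma> X) = X" "tgt C (\<sigma> X) = omap g (omap f X)"
    if "X \<in> Obj C" for X
    using \<sigma> that by (auto simp: natural_iso_def id_fctr_def fctr_comp_def)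
  have \<sigma>_nat: "\<sigma> (tgt C a) \<cdot>\<^bsub>C\<^esub> a = amap g (amap f a) \<cdot>\<^bsub>C\<^esub> \<sigma> (src C a)" if "a \<in> Arr C" for a
    using \<sigma> that by (auto simp: natural_iso_def id_fctr_def fctr_comp_def)
  have \<tau>_iso: "isomorphism D (\<tau> X)" "src D (\<tau> X) = omap f (omap g X)" "tgt D (\<tau> X) = X"
    if "X \<in> Obj D" for X
    using \<tau> that by (auto simp: natural_iso_def id_fctr_def fctr_comp_def)
  have \<tau>_nat: "\<tau> (tgt D a) \<cdot>\<^bsub>D\<^esub> amap f (amap g a) = a \<cdot>\<^bsub>D\<^esub> \<tau> (src D a)" if "a \<in> Arr D" for a
    using \<tau> that by (auto simp: natural_iso_def id_fctr_def fctr_comp_def)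
  have g_faithful: "a = b"
    if a: "a \<in> Arr D" and b: "b \<in> Arr D" and "src D a = src D b" "tgt D a = tgt D b"
      and "amap g a = amap g b" for a b
  proof -
    have eq: "a \<cdot>\<^bsub>D\<^esub> \<tau> (src D a) = b \<cdot>\<^bsub>D\<^esub> \<tau> (src D a)"
      using \<tau>_nat[OF a] \<tau>_nat[OF b] that by simp
    have X: "src D a \<in> Obj D" using D.src_Obj[OF a] .
    obtain t where t: "t \<in> Arr D" "src D t = src D a" "\<tau> (src D a) \<cdot>\<^bsub>D\<^esub> t = ident D (src D a)"
        "tgt D t = src D (\<tau> (src D a))"
      using D.isomorphism_inverse[OF \<tau>_iso(1)[OF X]] \<tau>_iso[OF X] isomorphism_Arr by metis
    have "c \<cdot>\<^bsub>D\<^esub> \<tau> (src D a) \<cdot>\<^bsub>D\<^esub> t = c" if "c \<in> Arr D" "src D c = src D a" for c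
      using that t \<tau>_iso[OF X] isomorphism_Arr[OF \<tau>_iso(1)[OF X]]
        D.cmp_assoc[of t "\<tau> (src D a)" c] D.cmp_ident_right[of c] by simp
    from this[OF a refl] this[OF b that(3)[symmetric]] show ?thesis unfolding eq by (rule trans[OF sym])
  qed
  obtain s where s: "s \<in> Arr C" "src C s = omap g (omap f B)" "tgt C s = B"
      "s \<cdot>\<^bsub>C\<^esub> \<sigma> B = ident C B" "\<sigma> B \<cdot>\<^bsub>C\<^esub> s = ident C (omap g (omap f B))"
    using C.isomorphism_inverse[OF \<sigma>_iso(1)[OF B]] \<sigma>_iso[OF B] isomorphism_Arr by metis
  note \<sigma>A = \<sigma>_iso[OF A] isomorphism_Arr[OF \<sigma>_iso(1)[OF A]]
  note \<sigma>B = \<sigma>_iso[OF B] isomorphism_Arr[OF \<sigma>_iso(1)[OF B]]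
  let ?gh\<sigma> = "amap g h \<cdot>\<^bsub>C\<^esub> \<sigma> A"
  have gh\<sigma>: "?gh\<sigma> \<in> Arr C" "src C ?gh\<sigma> = A" "tgt C ?gh\<sigma> = omap g (omap f B)"
    using g_Arr[OF h(1)] \<sigma>A h C.cmp_Arr C.src_cmp C.tgt_cmp by auto
  define k where "k = s \<cdot>\<^bsub>C\<^esub> ?gh\<sigma>"
  have k: "k \<in> Arr C" "src C k = A" "tgt C k = B"
    using gh\<sigma> s C.cmp_Arr C.src_cmp C.tgt_cmp by (auto simp: k_def)
  have "amap g (amap f k) \<cdot>\<^bsub>C\<^esub> \<sigma> A = \<sigma> B \<cdot>\<^bsub>C\<^esub> k"
    using \<sigma>_nat[OF k(1)] k by simp
  also have "\<dots> = ?gh\<sigma>"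
    using C.cmp_assoc[of ?gh\<sigma> s "\<sigma> B"] gh\<sigma> s \<sigma>B C.cmp_ident_left[OF gh\<sigma>(1)]
    by (simp add: k_def)
  finally have eq: "amap g (amap f k) \<cdot>\<^bsub>C\<^esub> \<sigma> A = amap g h \<cdot>\<^bsub>C\<^esub> \<sigma> A" .
  obtain r where r: "r \<in> Arr C" "src C r = omap g (omap f A)" "tgt C r = A"
      "\<sigma> A \<cdot>\<^bsub>C\<^esub> r = ident C (omap g (omap f A))"
    using C.isomorphism_inverse[OF \<sigma>_iso(1)[OF A]] \<sigma>_iso[OF A] isomorphism_Arr by metis
  have cancel: "c \<cdot>\<^bsub>C\<^esub> \<sigma> A \<cdot>\<^bsub>C\<^esub> r = c" if "c \<in> Arr C" "src C c = omap g (omap f A)" for c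
    using that r \<sigma>A C.cmp_assoc[of r "\<sigma> A" c] C.cmp_ident_right[of c] by simp
  have "amap g (amap f k) = amap g h"
  proof -
    have "amap g (amap f k) \<in> Arr C" "src C (amap g (amap f k)) = omap g (omap f A)"
      "amap g h \<in> Arr C" "src C (amap g h) = omap g (omap f A)"
      using g_Arr f_Arr k h by simp_all
    from cancel[OF this(1,2)] cancel[OF this(3,4)] show ?thesis
      unfolding eq by (rule trans[OF sym])
  qed
  then have "amap f k = h"
    using g_faithful f_Arr[OF k(1)] k h by simp
  with k that show thesis by blast
qed

section \<open>Words in a strict monoidal category\<close>

definition tensor_objs :: "('o, 'm, 'x) moncat_scheme \<Rightarrow> 'o list \<Rightarrow> 'o" where
  "tensor_objs C Xs = foldr (tenO C) Xs (unitO C)"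

definition tensor_arrs :: "('o, 'm, 'x) moncat_scheme \<Rightarrow> 'm list \<Rightarrow> 'm" where
  "tensor_arrs C as = foldr (tenA C) as (ident C (unitO C))"

lemma tensor_objs_simps [simp]:
  "tensor_objs C [] = unitO C" "tensor_objs C (X # Xs) = tenO C X (tensor_objs C Xs)"
  by (simp_all add: tensor_objs_def)

lemma tensor_arrs_simps [simp]:
  "tensor_arrs C [] = ident C (unitO C)" "tensor_arrs C (a # as) = tenA C a (tensor_arrs C as)"
  by (simp_all add: tensor_arrs_def)

context strict_monoidal_category
begin

lemma tensor_objs_Obj: "Xs \<in> lists (Obj C) \<Longrightarrow> tensor_objs C Xs \<in> Obj C"
  by (induction Xs) (auto simp: unit_Obj tenO_Obj)

lemma tensor_arrs_Arr:
  "as \<in> lists (Arr C) \<Longrightarrow> tensor_arrs C as \<in> Arr C \<and>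
    src C (tensor_arrs C as) = tensor_objs C (map (src C) as) \<and>
    tgt C (tensor_arrs C as) = tensor_objs C (map (tgt C) as)"
  by (induction as) (auto simp: unit_Obj ident_Arr src_ident tgt_ident tenA_Arr src_tenA tgt_tenA)

lemma tensor_objs_append:
  "Xs \<in> lists (Obj C) \<Longrightarrow> Ys \<in> lists (Obj C) \<Longrightarrow>
    tensor_objs C (Xs @ Ys) = tenO C (tensor_objs C Xs) (tensor_objs C Ys)"
  by (induction Xs) (auto simp: tenO_unit_left tenO_assoc tensor_objs_Obj)

lemma tensor_arrs_append:
  "as \<in> lists (Arr C) \<Longrightarrow> bs \<in> lists (Arr C) \<Longrightarrow>
    tensor_arrs C (as @ bs) = tenA C (tensor_arrs C as) (tensor_arrs C bs)"
  by (induction as) (auto simp: tenA_unit_left tenA_assoc tensor_arrs_Arr)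

lemma tensor_arrs_ident:
  "Xs \<in> lists (Obj C) \<Longrightarrow> tensor_arrs C (map (ident C) Xs) = ident C (tensor_objs C Xs)"
  by (induction Xs) (auto simp: tenA_ident tensor_objs_Obj)

end

section \<open>Unique tensor decomposition of the morphisms of a Feynman category\<close>

text \<open>The condition under which factorizations of \<open>\<phi> \<otimes> \<psi>\<close> are the same as pairs of factorizations:
  a tensor decomposition of the target of a morphism lifts uniquely to the morphism.\<close>

locale target_splitting_category = strict_monoidal_category F
  for F :: "('o, 'm, 'x) moncat_scheme" (structure) +
  assumes split: "\<lbrakk>\<chi> \<in> Arr F; Y \<in> Obj F; Y' \<in> Obj F; tgt F \<chi> = tenO F Y Y'\<rbrakk>
      \<Longrightarrow> \<exists>\<alpha> \<in> Arr F. \<exists>\<beta> \<in> Arr F. tgt F \<alpha> = Y \<and> tgt F \<beta> = Y' \<and> \<chi> = tenA F \<alpha> \<beta>"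
    and split_unique: "\<lbrakk>\<alpha> \<in> Arr F; \<alpha>' \<in> Arr F; \<beta> \<in> Arr F; \<beta>' \<in> Arr F;
        tgt F \<alpha> = tgt F \<alpha>'; tgt F \<beta> = tgt F \<beta>'; tenA F \<alpha> \<beta> = tenA F \<alpha>' \<beta>'\<rbrakk>
      \<Longrightarrow> \<alpha> = \<alpha>' \<and> \<beta> = \<beta>'"

lemma comma_FF_sel [simp]:
  "Obj (comma_FF F) = comma_objs F F F id_fctr id_fctr"
  "Arr (comma_FF F) = Arr (comma F F F id_fctr id_fctr)"
  "src (comma_FF F) = src (comma F F F id_fctr id_fctr)"
  "tgt (comma_FF F) = tgt (comma F F F id_fctr id_fctr)"
  "ident (comma_FF F) = ident (comma F F F id_fctr id_fctr)"
  "cmp (comma_FF F) = cmp (comma F F F id_fctr id_fctr)"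
  "unitO (comma_FF F) = (unitO F, unitO F, ident F (unitO F))"
  "tenO (comma_FF F) (X, Y, \<phi>) (X', Y', \<phi>') = (tenO F X X', tenO F Y Y', tenA F \<phi> \<phi>')"
  "tenA (comma_FF F) ((X, Y, \<phi>), (Z, W, \<chi>), \<psi>, \<omega>) ((X', Y', \<phi>'), (Z', W', \<chi>'), \<psi>', \<omega>') =
     ((tenO F X X', tenO F Y Y', tenA F \<phi> \<phi>'), (tenO F Z Z', tenO F W W', tenA F \<chi> \<chi>'),
      tenA F \<psi> \<psi>', tenA F \<omega> \<omega>')"
  by (simp_all add: comma_FF_def cat.defs moncat.defs comma_def)

lemma isomorphism_comma:
  assumes "isomorphism (comma C D E f g) h"
  shows "isomorphism C (fst (snd (snd h)))" and "isomorphism D (snd (snd (snd h)))"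
  using assms unfolding isomorphism_def comma_def by (auto split: prod.splits)

locale strict_feynman_category =
  fixes V :: "('o, 'm) cat" and F :: "('o, 'm) moncat" and \<iota> :: "('o, 'm, 'o, 'm) fctr"
    and U :: "'u itself"
  assumes feynman: "strict_nonsigma_feynman_category U V F \<iota>"
begin

sublocale F: strict_monoidal_category F
  using feynman
  by (simp add: strict_nonsigma_feynman_category_def nonsigma_feynman_category_def)

lemma \<iota>_functor: "is_functor V F \<iota>"
  using feynman
  by (simp add: strict_nonsigma_feynman_category_def nonsigma_feynman_category_def)

sublocale V: category V
  using \<iota>_functor by (simp add: is_functor_def)

lemma \<iota>_Obj: "X \<in> Obj V \<Longrightarrow> omap \<iota> X = X" and \<iota>_Arr: "a \<in> Arr V \<Longrightarrow> amap \<iota> a = a"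
  using feynman by (simp_all add: strict_nonsigma_feynman_category_def)

lemma V_Obj: "X \<in> Obj V \<Longrightarrow> X \<in> Obj F"
  using \<iota>_functor \<iota>_Obj unfolding is_functor_def by metis

lemma V_ident: "X \<in> Obj V \<Longrightarrow> ident V X = ident F X"
  using \<iota>_functor \<iota>_Obj \<iota>_Arr V.ident_Arr unfolding is_functor_def by metis

lemma V_Arr: "a \<in> Arr V \<Longrightarrow> a \<in> Arr F"
  and V_src: "a \<in> Arr V \<Longrightarrow> src V a = src F a"
  and V_tgt: "a \<in> Arr V \<Longrightarrow> tgt V a = tgt F a"
  using \<iota>_functor \<iota>_Obj \<iota>_Arr V.src_Obj V.tgt_Obj unfolding is_functor_def by metis+

lemma V_lists: "Xs \<in> lists (Obj V) \<Longrightarrow> Xs \<in> lists (Obj F)" "as \<in> lists (Arr V) \<Longrightarrow> as \<in> lists (Arr F)"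
  using V_Obj V_Arr by (auto simp: in_lists_conv_set)

lemma V_lists_src_tgt:
  "as \<in> lists (Arr V) \<Longrightarrow> map (src F) as \<in> lists (Obj V)"
  "as \<in> lists (Arr V) \<Longrightarrow> map (tgt F) as \<in> lists (Obj V)"
proof -
  assume as: "as \<in> lists (Arr V)"
  have "map (src F) as = map (src V) as" "map (tgt F) as = map (tgt V) as"
    using as by (simp_all add: in_lists_conv_set V_src V_tgt)
  then show "map (src F) as \<in> lists (Obj V)" "map (tgt F) as \<in> lists (Obj V)"
    using as V.src_Obj V.tgt_Obj by (auto simp: in_lists_conv_set)
qed

lemma
  shows tensor_objs_bij: "bij_betw (tensor_objs F) (lists (Obj V)) (Obj F)"
    and tensor_arrs_bij: "bij_betw (tensor_arrs F) (lists (Arr V)) {f. isomorphism F f}"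
proof -
  have iso: "bij_betw (omap (free_ext F \<iota>)) (lists (Obj V)) (Obj F)"
    "bij_betw (amap (free_ext F \<iota>)) (lists (Arr V)) {f. isomorphism F f}"
    using feynman
    by (simp_all add: strict_nonsigma_feynman_category_def cat_isomorphism_def free_moncat_def)
  have "omap (free_ext F \<iota>) Xs = tensor_objs F Xs" if "Xs \<in> lists (Obj V)" for Xs
    using that \<iota>_Obj by (simp add: free_ext_def tensor_objs_def in_lists_conv_set map_idI)
  moreover have "amap (free_ext F \<iota>) as = tensor_arrs F as" if "as \<in> lists (Arr V)" for as
    using that \<iota>_Arr by (simp add: free_ext_def tensor_arrs_def in_lists_conv_set map_idI)
  ultimately show "bij_betw (tensor_objs F) (lists (Obj V)) (Obj F)"
    "bij_betw (tensor_arrs F) (lists (Arr V)) {f. isomorphism F f}"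
    using iso bij_betw_cong[of "lists (Obj V)" "omap (free_ext F \<iota>)" "tensor_objs F"]
      bij_betw_cong[of "lists (Arr V)" "amap (free_ext F \<iota>)" "tensor_arrs F"] by simp_all
qed

lemma Obj_word:
  assumes "X \<in> Obj F" obtains Xs where "Xs \<in> lists (Obj V)" "X = tensor_objs F Xs"
  using assms tensor_objs_bij by (auto simp: bij_betw_def)

lemma iso_word:
  assumes "isomorphism F f" obtains as where "as \<in> lists (Arr V)" "f = tensor_arrs F as"
  using assms tensor_arrs_bij by (auto simp: bij_betw_def)

lemma tensor_objs_inj:
  "Xs \<in> lists (Obj V) \<Longrightarrow> Ys \<in> lists (Obj V) \<Longrightarrow> tensor_objs F Xs = tensor_objs F Ys \<Longrightarrow> Xs = Ys"
  using tensor_objs_bij by (auto simp: bij_betw_def dest: inj_onD)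

lemma tensor_arrs_inj:
  "as \<in> lists (Arr V) \<Longrightarrow> bs \<in> lists (Arr V) \<Longrightarrow> tensor_arrs F as = tensor_arrs F bs \<Longrightarrow> as = bs"
  using tensor_arrs_bij by (auto simp: bij_betw_def dest: inj_onD)

lemma V_Arr_isomorphism: "a \<in> Arr V \<Longrightarrow> isomorphism F a"
  using bij_betw_imp_surj_on[OF tensor_arrs_bij] F.tenA_unit_right[OF V_Arr, of a]
  by (force dest: equalityD1 simp: image_subset_iff Ball_def elim!: allE[of _ "[a]"])

text \<open>Isomorphisms multiply freely, so a tensor product of them is an identity only letter by
  letter.\<close>

lemma iso_tensor_eq_ident:
  assumes "\<And>s. s \<in> set ss \<Longrightarrow> isomorphism F s" and "tensor_arrs F ss = ident F X" and "X \<in> Obj F"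
    and s: "s \<in> set ss"
  shows "s = ident F (src F s)"
proof -
  have "\<exists>as \<in> lists (Arr V). s = tensor_arrs F as" if "s \<in> set ss" for s
    using iso_word[OF assms(1)[OF that]] by blast
  then obtain l where l: "\<And>s. s \<in> set ss \<Longrightarrow> l s \<in> lists (Arr V)"
      "\<And>s. s \<in> set ss \<Longrightarrow> s = tensor_arrs F (l s)"
    by metis
  have concat: "tensor_arrs F ts = tensor_arrs F (concat (map l ts)) \<and>
      concat (map l ts) \<in> lists (Arr V)" if "set ts \<subseteq> set ss" for ts
    using that
  proof (induction ts)
    case (Cons t ts)
    then have "tensor_arrs F (l t @ concat (map l ts)) = tenA F t (tensor_arrs F ts)"
      using F.tensor_arrs_append[OF V_lists(2)[OF l(1)] V_lists(2)] l(2)[of t] by auto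
    then show ?case using Cons l(1) by auto
  qed simp
  obtain Xs where Xs: "Xs \<in> lists (Obj V)" "X = tensor_objs F Xs"
    using Obj_word \<open>X \<in> Obj F\<close> by blast
  have ids: "map (ident F) Xs \<in> lists (Arr V)"
    using Xs V.ident_Arr by (auto simp: in_lists_conv_set simp flip: V_ident)
  have letters: "concat (map l ss) = map (ident F) Xs"
  proof (rule tensor_arrs_inj[OF _ ids])
    show "tensor_arrs F (concat (map l ss)) = tensor_arrs F (map (ident F) Xs)"
      using concat[OF subset_refl] assms(2) F.tensor_arrs_ident[OF V_lists(1)[OF Xs(1)]] Xs(2)
      by (simp only:)
  qed (use concat[OF subset_refl] in blast)
  have "set (l s) \<subseteq> set (concat (map l ss))"
    using s by auto
  then have "set (l s) \<subseteq> ident F ` set Xs"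
    by (simp only: letters set_map)
  then have "l s \<in> map (ident F) ` lists (set Xs)"
    unfolding lists_image[symmetric] by (auto simp: in_lists_conv_set)
  then obtain Ys where "l s = map (ident F) Ys" "Ys \<in> lists (set Xs)"
    by blast
  moreover from this Xs have "Ys \<in> lists (Obj F)"
    using V_Obj by (auto simp: in_lists_conv_set)
  ultimately have "s = ident F (tensor_objs F Ys)" "tensor_objs F Ys \<in> Obj F"
    using l(2)[OF s] F.tensor_arrs_ident F.tensor_objs_Obj by auto
  then show ?thesis
    using F.src_ident by metis
qed

text \<open>The morphisms into an object of \<open>V\<close> are the letters of the decomposition.\<close>

definition basic :: "'m set" where
  "basic = {m \<in> Arr F. tgt F m \<in> Obj V}"

definition comma_point :: "'m \<Rightarrow> ('o, 'o, 'm) comma_obj" where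
  "comma_point m = (src F m, tgt F m, m)"

abbreviation "eval_comma \<equiv> free_ext (comma_FF F) (comma_incl \<iota>)"

lemma basic_lists:
  "ms \<in> lists basic \<Longrightarrow> ms \<in> lists (Arr F)" "ms \<in> lists basic \<Longrightarrow> map (tgt F) ms \<in> lists (Obj V)"
  "ms \<in> lists basic \<Longrightarrow> map (src F) ms \<in> lists (Obj F)"
  using F.src_Obj by (auto simp: in_lists_conv_set basic_def)

lemma eval_comma_equivalence:
  "cat_equivalence (free_moncat (Iso_cat (comma_FV V F \<iota>))) (Iso_cat (comma_FF F)) eval_comma"
  using feynman
  by (simp add: strict_nonsigma_feynman_category_def nonsigma_feynman_category_def
      monoidal_equivalence_def)

lemma Obj_comma_FV: "Obj (comma_FV V F \<iota>) = comma_point ` basic"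
  using \<iota>_Obj F.src_Obj
  by (auto simp: comma_FV_def comma_def comma_objs_def id_fctr_def comma_point_def basic_def image_iff)

lemma eval_comma_Obj:
  assumes "ms \<in> lists basic"
  shows "omap eval_comma (map comma_point ms) = comma_point (tensor_arrs F ms)"
proof -
  have "omap eval_comma (map comma_point ms)
      = (tensor_objs F (map (src F) ms), tensor_objs F (map (tgt F) ms), tensor_arrs F ms)"
    using assms
    by (induction ms) (auto simp: free_ext_def comma_incl_def comma_point_def basic_def \<iota>_Obj)
  then show ?thesis
    using F.tensor_arrs_Arr[OF basic_lists(1)[OF assms]] by (simp add: comma_point_def)
qed

lemma eval_comma_Arr:
  assumes "\<And>h. h \<in> set k \<Longrightarrow> snd (snd (snd h)) \<in> Arr V"
  shows "snd (snd (amap eval_comma k)) =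
    (tensor_arrs F (map (\<lambda>h. fst (snd (snd h))) k), tensor_arrs F (map (\<lambda>h. snd (snd (snd h))) k))"
proof -
  have "\<exists>S T. amap eval_comma k = (S, T, tensor_arrs F (map (\<lambda>h. fst (snd (snd h))) k),
      tensor_arrs F (map (\<lambda>h. snd (snd (snd h))) k))"
    using assms
  proof (induction k)
    case Nil
    then show ?case by (simp add: free_ext_def comma_def)
  next
    case (Cons h k)
    obtain X v \<phi> X' v' \<phi>' \<psi> \<omega> where h: "h = ((X, v, \<phi>), (X', v', \<phi>'), \<psi>, \<omega>)"
      by (metis prod.exhaust)
    obtain S T where k: "amap eval_comma k = (S, T, tensor_arrs F (map (\<lambda>h. fst (snd (snd h))) k),
        tensor_arrs F (map (\<lambda>h. snd (snd (snd h))) k))"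
      using Cons by auto
    obtain Y Z \<chi> Y' Z' \<chi>' where "S = (Y, Z, \<chi>)" "T = (Y', Z', \<chi>')"
      by (metis prod.exhaust)
    with k h \<iota>_Arr Cons.prems[of h] show ?case
      by (simp add: free_ext_def comma_incl_def)
  qed
  then show ?thesis by auto
qed

text \<open>Isomorphisms before and after a tensor product of basic morphisms decompose along it, since
  they are words of arrows of \<open>V\<close>; so they can be composed into the letters.\<close>

lemma absorb_isos:
  assumes "ms \<in> lists basic" "w \<in> lists (Arr V)" "map (src F) w = map (tgt F) ms"
    and "u \<in> lists (Arr V)" "tgt F (tensor_arrs F u) = tensor_objs F (map (src F) ms)"
  shows "\<exists>ns \<in> lists basic. tensor_arrs F w \<cdot>\<^bsub>F\<^esub> tensor_arrs F ms \<cdot>\<^bsub>F\<^esub> tensor_arrs F u = tensor_arrs F ns"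
  using assms
proof (induction ms arbitrary: w u)
  case Nil
  have "map (tgt F) u = []"
    using Nil F.tensor_arrs_Arr[OF V_lists(2)[OF \<open>u \<in> lists (Arr V)\<close>]]
    by (intro tensor_objs_inj V_lists_src_tgt) auto
  moreover have "ident F (unitO F) \<cdot>\<^bsub>F\<^esub> ident F (unitO F) = ident F (unitO F)"
    using F.cmp_ident_left[OF F.ident_Arr[OF F.unit_Obj]] F.unit_Obj F.tgt_ident by simp
  ultimately show ?case
    using Nil by (intro bexI[of _ "[]"]) auto
next
  case (Cons m ms)
  obtain a w' where w: "w = a # w'" "src F a = tgt F m" "map (src F) w' = map (tgt F) ms"
    using Cons.prems by (cases w) auto
  have m: "m \<in> basic" "m \<in> Arr F" "ms \<in> lists basic" and a: "a \<in> Arr V" "a \<in> Arr F" "w' \<in> lists (Arr V)"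
    using Cons.hyps Cons.prems w V_Arr by (auto simp: basic_def)
  note u = \<open>u \<in> lists (Arr V)\<close>
  obtain xs where xs: "xs \<in> lists (Obj V)" "src F m = tensor_objs F xs"
    using Obj_word F.src_Obj m by blast
  obtain ys where ys: "ys \<in> lists (Obj V)" "tensor_objs F (map (src F) ms) = tensor_objs F ys"
    using Obj_word F.tensor_objs_Obj[OF basic_lists(3)[OF m(3)]] by metis
  have "map (tgt F) u = xs @ ys"
  proof (rule tensor_objs_inj)
    show "tensor_objs F (map (tgt F) u) = tensor_objs F (xs @ ys)"
      using Cons.prems(4) F.tensor_arrs_Arr[OF V_lists(2)[OF u]] xs ys
        F.tensor_objs_append[OF V_lists(1) V_lists(1)] by simp
  qed (use u xs ys V_lists_src_tgt in auto)
  then obtain u1 u2 where u12: "u = u1 @ u2" "map (tgt F) u1 = xs" "map (tgt F) u2 = ys"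
    by (metis map_eq_append_conv)
  have u12_V: "u1 \<in> lists (Arr V)" "u2 \<in> lists (Arr V)"
    using u u12 by auto
  note u1 = F.tensor_arrs_Arr[OF V_lists(2)[OF u12_V(1)]]
    and u2 = F.tensor_arrs_Arr[OF V_lists(2)[OF u12_V(2)]]
    and ms = F.tensor_arrs_Arr[OF basic_lists(1)[OF m(3)]]
    and w' = F.tensor_arrs_Arr[OF V_lists(2)[OF a(3)]]
  obtain ns where ns: "ns \<in> lists basic"
    "tensor_arrs F w' \<cdot>\<^bsub>F\<^esub> tensor_arrs F ms \<cdot>\<^bsub>F\<^esub> tensor_arrs F u2 = tensor_arrs F ns"
    using Cons.IH[OF a(3) w(3) u12_V(2)] u2 u12 ys by auto
  let ?n = "a \<cdot>\<^bsub>F\<^esub> m \<cdot>\<^bsub>F\<^esub> tensor_arrs F u1"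
  have am: "a \<cdot>\<^bsub>F\<^esub> m \<in> Arr F" "src F (a \<cdot>\<^bsub>F\<^esub> m) = src F m" "tgt F (a \<cdot>\<^bsub>F\<^esub> m) = tgt F a"
    using F.cmp_Arr F.src_cmp F.tgt_cmp m a w by auto
  have wm: "tensor_arrs F w' \<cdot>\<^bsub>F\<^esub> tensor_arrs F ms \<in> Arr F"
    "src F (tensor_arrs F w' \<cdot>\<^bsub>F\<^esub> tensor_arrs F ms) = tensor_objs F ys"
    using F.cmp_Arr F.src_cmp ms w' w(3) ys by auto
  have "tgt F (tensor_arrs F u1) = src F m" "tgt F (tensor_arrs F u2) = tensor_objs F ys"
    using u1 u2 u12 xs ys by auto
  note tgts = this
  have "?n \<in> basic"
    using am F.cmp_Arr F.tgt_cmp u1 tgts V.tgt_Obj[OF a(1)] V_tgt[OF a(1)] by (auto simp: basic_def)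
  moreover have "tensor_arrs F w \<cdot>\<^bsub>F\<^esub> tensor_arrs F (m # ms) \<cdot>\<^bsub>F\<^esub> tensor_arrs F u = tensor_arrs F (?n # ns)"
  proof -
    have "tensor_arrs F w \<cdot>\<^bsub>F\<^esub> tensor_arrs F (m # ms) = tenA F (a \<cdot>\<^bsub>F\<^esub> m) (tensor_arrs F w' \<cdot>\<^bsub>F\<^esub> tensor_arrs F ms)"
      using F.interchange[of m a "tensor_arrs F ms" "tensor_arrs F w'"] m a ms w' w by simp
    moreover have "tensor_arrs F u = tenA F (tensor_arrs F u1) (tensor_arrs F u2)"
      using F.tensor_arrs_append[OF V_lists(2)[OF u12_V(1)] V_lists(2)[OF u12_V(2)]] u12(1) by simp
    ultimately show ?thesis
      using F.interchange[of "tensor_arrs F u1" "a \<cdot>\<^bsub>F\<^esub> m" "tensor_arrs F u2"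
          "tensor_arrs F w' \<cdot>\<^bsub>F\<^esub> tensor_arrs F ms"] am wm u1 u2 tgts ns(2) by simp
  qed
  ultimately show ?case
    using ns(1) by (intro bexI[of _ "?n # ns"]) auto
qed

text \<open>Essential surjectivity of the evaluation gives a decomposition up to isomorphism in the comma
  category, that is, up to isomorphisms of the source and of the target; these are absorbed.\<close>

lemma tensor_arrs_basic_surj:
  assumes \<phi>: "\<phi> \<in> Arr F" obtains ms where "ms \<in> lists basic" "\<phi> = tensor_arrs F ms"
proof -
  have "comma_point \<phi> \<in> Obj (Iso_cat (comma_FF F))"
    using \<phi> F.src_Obj F.tgt_Obj by (simp add: comma_objs_def id_fctr_def comma_point_def)
  with eval_comma_equivalence obtain A h where A: "A \<in> Obj (free_moncat (Iso_cat (comma_FV V F \<iota>)))"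
    and h: "isomorphism (Iso_cat (comma_FF F)) h"
      "src (Iso_cat (comma_FF F)) h = omap eval_comma A"
      "tgt (Iso_cat (comma_FF F)) h = comma_point \<phi>"
    by (rule cat_equivalence_essentially_surjective)
  obtain ms where ms: "ms \<in> lists basic" "A = map comma_point ms"
    using A by (auto simp: free_moncat_def Obj_comma_FV lists_image)
  note ms_Arr = F.tensor_arrs_Arr[OF basic_lists(1)[OF ms(1)]]
  have "isomorphism (comma F F F id_fctr id_fctr) h"
    using isomorphism_Iso_cat[OF h(1)] by (simp add: isomorphism_def)
  note h_iso = isomorphism_comma[OF this] isomorphism_Arr[OF this]
  obtain S T \<sigma> \<tau> where h_eq: "h = (S, T, \<sigma>, \<tau>)"
    by (metis prod.exhaust)
  have "S = comma_point (tensor_arrs F ms)" "T = comma_point \<phi>"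
    using h(2,3) h_eq eval_comma_Obj[OF ms(1)] ms(2) by (simp_all add: comma_def)
  then have \<sigma>: "isomorphism F \<sigma>" "src F \<sigma> = src F (tensor_arrs F ms)" "tgt F \<sigma> = src F \<phi>"
    and \<tau>: "isomorphism F \<tau>" "src F \<tau> = tgt F (tensor_arrs F ms)" "tgt F \<tau> = tgt F \<phi>"
    and square: "\<tau> \<cdot>\<^bsub>F\<^esub> tensor_arrs F ms = \<phi> \<cdot>\<^bsub>F\<^esub> \<sigma>"
    using h_iso h_eq by (auto simp: comma_def comma_point_def id_fctr_def)
  obtain \<rho> where \<rho>: "isomorphism F \<rho>" "src F \<rho> = src F \<phi>" "tgt F \<rho> = src F \<sigma>"
      "\<sigma> \<cdot>\<^bsub>F\<^esub> \<rho> = ident F (src F \<phi>)"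
    using F.isomorphism_inverse[OF \<sigma>(1)] \<sigma>(3) by metis
  have \<phi>_eq: "\<phi> = \<tau> \<cdot>\<^bsub>F\<^esub> tensor_arrs F ms \<cdot>\<^bsub>F\<^esub> \<rho>"
    unfolding square
    using F.cmp_assoc[of \<rho> \<sigma> \<phi>] \<rho> \<sigma> \<phi> isomorphism_Arr F.cmp_ident_right[OF \<phi>] by metis
  obtain w where w: "w \<in> lists (Arr V)" "\<tau> = tensor_arrs F w"
    using iso_word[OF \<tau>(1)] .
  obtain u where u: "u \<in> lists (Arr V)" "\<rho> = tensor_arrs F u"
    using iso_word[OF \<rho>(1)] .
  have "map (src F) w = map (tgt F) ms"
    using \<tau>(2) w F.tensor_arrs_Arr[OF V_lists(2)[OF w(1)]] ms_Arr
    by (intro tensor_objs_inj V_lists_src_tgt basic_lists ms) auto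
  from absorb_isos[OF ms(1) w(1) this u(1)] show thesis
    using \<rho>(3) \<sigma>(2) ms_Arr \<phi>_eq w u that by auto
qed

text \<open>An equality of two tensor products is an identity arrow between their decompositions.  It is
  the image of a word of isomorphisms of the letters, and by freeness all of these are
  identities.\<close>

lemma tensor_arrs_basic_inj:
  assumes ms: "ms \<in> lists basic" and ns: "ns \<in> lists basic"
    and eq: "tensor_arrs F ms = tensor_arrs F ns"
  shows "ms = ns"
proof -
  let ?\<phi> = "tensor_arrs F ns"
  let ?id = "ident (comma_FF F) (comma_point ?\<phi>)"
  note \<phi> = F.tensor_arrs_Arr[OF basic_lists(1)[OF ns], THEN conjunct1]
  have point: "comma_point ?\<phi> \<in> Obj (Iso_cat (comma_FF F))"
    using \<phi> F.src_Obj F.tgt_Obj by (simp add: comma_objs_def id_fctr_def comma_point_def)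
  interpret FF: category "Iso_cat (comma_FF F)"
    using eval_comma_equivalence by (simp add: cat_equivalence_def is_functor_def)
  have objs: "map comma_point ls \<in> Obj (free_moncat (Iso_cat (comma_FV V F \<iota>)))"
    if "ls \<in> lists basic" for ls
    using that by (auto simp: free_moncat_def Obj_comma_FV lists_image)
  have id_arr: "?id \<in> Arr (Iso_cat (comma_FF F))"
    "src (Iso_cat (comma_FF F)) ?id = omap eval_comma (map comma_point ms)"
    "tgt (Iso_cat (comma_FF F)) ?id = omap eval_comma (map comma_point ns)"
    using FF.ident_Arr[OF point] FF.src_ident[OF point] FF.tgt_ident[OF point]
    by (simp_all add: eval_comma_Obj ms ns eq)
  obtain k where k: "k \<in> Arr (free_moncat (Iso_cat (comma_FV V F \<iota>)))"
      "src (free_moncat (Iso_cat (comma_FV V F \<iota>))) k = map comma_point ms"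
      "tgt (free_moncat (Iso_cat (comma_FV V F \<iota>))) k = map comma_point ns"
      "amap eval_comma k = ?id"
    using cat_equivalence_full[OF eval_comma_equivalence objs[OF ms] objs[OF ns] id_arr] .
  have letter: "isomorphism (comma F V F id_fctr \<iota>) h" if "h \<in> set k" for h
    using k(1) that by (auto simp: free_moncat_def comma_FV_def in_lists_conv_set)
  note iso = isomorphism_comma(1)[OF letter] isomorphism_Arr[OF isomorphism_comma(2)[OF letter]]
    and arr = isomorphism_Arr[OF letter]
  have "tensor_arrs F (map (\<lambda>h. fst (snd (snd h))) k) = ident F (src F ?\<phi>)"
    "tensor_arrs F (map (\<lambda>h. snd (snd (snd h))) k) = ident F (tgt F ?\<phi>)"
    using eval_comma_Arr[of k, OF iso(2)] k(4) by (simp_all add: comma_def comma_point_def)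
  note idents = iso_tensor_eq_ident[OF _ this(1) F.src_Obj[OF \<phi>]]
    iso_tensor_eq_ident[OF _ this(2) F.tgt_Obj[OF \<phi>]]
  have "fst (snd h) = fst h" if h: "h \<in> set k" for h
  proof -
    obtain X v \<chi> X' v' \<chi>' \<psi> \<omega> where h_eq: "h = ((X, v, \<chi>), (X', v', \<chi>'), \<psi>, \<omega>)"
      by (metis prod.exhaust)
    have "fst (snd (snd h)) = ident F (src F (fst (snd (snd h))))"
      by (rule idents(1)) (use h iso(1) in auto)
    moreover have "snd (snd (snd h)) = ident F (src F (snd (snd (snd h))))"
      by (rule idents(2)) (use h V_Arr_isomorphism[OF iso(2)] in auto)
    ultimately have "\<psi> = ident F (src F \<psi>)" "\<omega> = ident F (src F \<omega>)"
      by (simp_all only: h_eq fst_conv snd_conv)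
    moreover have "\<chi> \<in> Arr F" "src F \<chi> = X" "tgt F \<chi> = v" "\<chi>' \<in> Arr F" "src F \<chi>' = X'"
      "tgt F \<chi>' = v'" "\<psi> \<in> Arr F" "\<omega> \<in> Arr V" "\<omega> \<in> Arr F"
      "src F \<psi> = X" "tgt F \<psi> = X'" "src F \<omega> = v" "tgt F \<omega> = v'" "\<omega> \<cdot>\<^bsub>F\<^esub> \<chi> = \<chi>' \<cdot>\<^bsub>F\<^esub> \<psi>"
      using arr[OF h] h_eq \<iota>_Obj \<iota>_Arr V_Arr V_src V_tgt
      by (auto simp: comma_def comma_objs_def id_fctr_def)
    ultimately have "X' = X" "v' = v" "\<chi> = \<chi>'"
      using F.cmp_ident_left F.cmp_ident_right F.src_Obj F.tgt_Obj F.tgt_ident by metis+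
    then show ?thesis by (simp add: h_eq)
  qed
  then have same: "map fst k = map (\<lambda>h. fst (snd h)) k" by simp
  have "src (comma_FV V F \<iota>) = fst" "tgt (comma_FV V F \<iota>) = (\<lambda>h. fst (snd h))"
    by (auto simp: comma_FV_def comma_def fun_eq_iff)
  then have "map fst k = map comma_point ms" "map (\<lambda>h. fst (snd h)) k = map comma_point ns"
    using k(2,3) by (simp_all add: free_moncat_def)
  then have "map comma_point ms = map comma_point ns"
    by (simp only: same)
  then show ?thesis
    by (rule map_injective) (auto simp: inj_on_def comma_point_def)
qed

text \<open>The targets of the letters spell the word of the target, so a decomposition of the target cuts
  the word of letters at a determined place.\<close>

sublocale target_splitting_category F
proof
  fix \<chi> Y Y'
  assume \<chi>: "\<chi> \<in> Arr F" and Y: "Y \<in> Obj F" and Y': "Y' \<in> Obj F" and tgt: "tgt F \<chi> = tenO F Y Y'"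
  obtain ms where ms: "ms \<in> lists basic" "\<chi> = tensor_arrs F ms"
    using tensor_arrs_basic_surj[OF \<chi>] .
  obtain ys where ys: "ys \<in> lists (Obj V)" "Y = tensor_objs F ys"
    using Obj_word[OF Y] .
  obtain ys' where ys': "ys' \<in> lists (Obj V)" "Y' = tensor_objs F ys'"
    using Obj_word[OF Y'] .
  have "map (tgt F) ms = ys @ ys'"
  proof (rule tensor_objs_inj)
    show "tensor_objs F (map (tgt F) ms) = tensor_objs F (ys @ ys')"
      using tgt ms ys ys' F.tensor_arrs_Arr[OF basic_lists(1)[OF ms(1)]]
        F.tensor_objs_append[OF V_lists(1) V_lists(1)] by simp
  qed (use ms ys ys' basic_lists in auto)
  then obtain ms1 ms2 where ms12: "ms = ms1 @ ms2" "map (tgt F) ms1 = ys" "map (tgt F) ms2 = ys'"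
    by (metis map_eq_append_conv)
  have ms12_Arr: "ms1 \<in> lists (Arr F)" "ms2 \<in> lists (Arr F)"
    using basic_lists(1)[OF ms(1)] ms12 by auto
  show "\<exists>\<alpha> \<in> Arr F. \<exists>\<beta> \<in> Arr F. tgt F \<alpha> = Y \<and> tgt F \<beta> = Y' \<and> \<chi> = tenA F \<alpha> \<beta>"
    using F.tensor_arrs_Arr[OF ms12_Arr(1)] F.tensor_arrs_Arr[OF ms12_Arr(2)]
      F.tensor_arrs_append[OF ms12_Arr] ms(2) ms12 ys(2) ys'(2) by auto
next
  fix \<alpha> \<alpha>' \<beta> \<beta>'
  assume Arr: "\<alpha> \<in> Arr F" "\<alpha>' \<in> Arr F" "\<beta> \<in> Arr F" "\<beta>' \<in> Arr F"
    and tgt: "tgt F \<alpha> = tgt F \<alpha>'" "tgt F \<beta> = tgt F \<beta>'" and eq: "tenA F \<alpha> \<beta> = tenA F \<alpha>' \<beta>'"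
  obtain as where as: "as \<in> lists basic" "\<alpha> = tensor_arrs F as"
    using tensor_arrs_basic_surj[OF Arr(1)] .
  obtain as' where as': "as' \<in> lists basic" "\<alpha>' = tensor_arrs F as'"
    using tensor_arrs_basic_surj[OF Arr(2)] .
  obtain bs where bs: "bs \<in> lists basic" "\<beta> = tensor_arrs F bs"
    using tensor_arrs_basic_surj[OF Arr(3)] .
  obtain bs' where bs': "bs' \<in> lists basic" "\<beta>' = tensor_arrs F bs'"
    using tensor_arrs_basic_surj[OF Arr(4)] .
  have "map (tgt F) as = map (tgt F) as'"
    using tgt(1) as as' F.tensor_arrs_Arr[OF basic_lists(1)]
    by (intro tensor_objs_inj basic_lists) auto
  then have "length as = length as'" by (metis length_map)
  moreover have "as @ bs = as' @ bs'"
    using eq as as' bs bs' F.tensor_arrs_append[OF basic_lists(1) basic_lists(1)]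
    by (intro tensor_arrs_basic_inj) auto
  ultimately show "\<alpha> = \<alpha>' \<and> \<beta> = \<beta>'"
    using as as' bs bs' by simp
qed

end

section \<open>The bialgebra of morphisms\<close>

context target_splitting_category
begin

text \<open>An arrow \<open>\<phi>\<close> into the unit object satisfies \<open>\<phi> \<otimes> id = id \<otimes> \<phi>\<close>, and both sides decompose the
  same arrow along the same targets.\<close>

lemma arr_into_unit:
  assumes "\<phi> \<in> Arr F" "tgt F \<phi> = unitO F"
  shows "\<phi> = ident F (unitO F)"
proof -
  have "tenA F \<phi> (ident F (unitO F)) = tenA F (ident F (unitO F)) \<phi>"
    using assms tenA_unit_left tenA_unit_right by simp
  then have "\<phi> = ident F (unitO F) \<and> ident F (unitO F) = \<phi>"
    using assms unit_Obj ident_Arr tgt_ident by (intro split_unique) auto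
  then show ?thesis ..
qed

text \<open>This makes the unit grouplike: both factors of the unit arrow end in the unit object, the second
  one because the first is an identity.\<close>

lemma factorizations_unit:
  "factorizations F (ident F (unitO F)) = {(ident F (unitO F), ident F (unitO F))}"
proof -
  have id: "ident F (unitO F) \<in> Arr F" "src F (ident F (unitO F)) = unitO F"
    "tgt F (ident F (unitO F)) = unitO F"
    using unit_Obj ident_Arr src_ident tgt_ident by auto
  have comp: "ident F (unitO F) = ident F (unitO F) \<cdot> ident F (unitO F)"
    using cmp_ident_left[OF id(1)] id by simp
  have "\<phi>0 = ident F (unitO F) \<and> \<phi>1 = ident F (unitO F)"
    if "(\<phi>0, \<phi>1) \<in> factorizations F (ident F (unitO F))" for \<phi>0 \<phi>1
  proof -
    have f: "\<phi>0 \<in> Arr F" "\<phi>1 \<in> Arr F" "src F \<phi>0 = tgt F \<phi>1" "ident F (unitO F) = \<phi>0 \<cdot> \<phi>1"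
      using that by (auto simp: factorizations_def)
    have "tgt F \<phi>0 = unitO F"
      using tgt_cmp[OF f(2,1,3)] id(3) by (simp only: f(4)[symmetric])
    with f(1) have \<phi>0: "\<phi>0 = ident F (unitO F)"
      by (rule arr_into_unit)
    have "tgt F \<phi>1 = unitO F"
      using f(3) id(2) by (simp only: \<phi>0)
    with f(2) have "\<phi>1 = ident F (unitO F)"
      by (rule arr_into_unit)
    with \<phi>0 show ?thesis ..
  qed
  moreover have "(ident F (unitO F), ident F (unitO F)) \<in> factorizations F (ident F (unitO F))"
    unfolding factorizations_def using id comp by (simp only: mem_Collect_eq prod.case)
  ultimately show ?thesis
    by auto
qed

text \<open>Multiplicativity of the counit: \<open>\<phi> \<otimes> \<psi> = id\<close> is compared with the tensor product of the
  identities of the targets of \<open>\<phi>\<close> and \<open>\<psi>\<close>.\<close>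

lemma ident_tensor_iff:
  assumes "\<phi> \<in> Arr F" "\<psi> \<in> Arr F"
  shows "(\<exists>Z \<in> Obj F. tenA F \<phi> \<psi> = ident F Z) \<longleftrightarrow>
    (\<exists>X \<in> Obj F. \<phi> = ident F X) \<and> (\<exists>Y \<in> Obj F. \<psi> = ident F Y)"
proof
  assume "\<exists>Z \<in> Obj F. tenA F \<phi> \<psi> = ident F Z"
  then obtain Z where Z: "Z \<in> Obj F" "tenA F \<phi> \<psi> = ident F Z" by blast
  then have "Z = tenO F (tgt F \<phi>) (tgt F \<psi>)"
    using tgt_tenA[OF assms] tgt_ident[OF Z(1)] by simp
  then have "tenA F \<phi> \<psi> = tenA F (ident F (tgt F \<phi>)) (ident F (tgt F \<psi>))"
    using Z tenA_ident tgt_Obj assms by simp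
  then have "\<phi> = ident F (tgt F \<phi>) \<and> \<psi> = ident F (tgt F \<psi>)"
    using assms tgt_Obj ident_Arr tgt_ident by (intro split_unique) auto
  then show "(\<exists>X \<in> Obj F. \<phi> = ident F X) \<and> (\<exists>Y \<in> Obj F. \<psi> = ident F Y)"
    using assms tgt_Obj by blast
qed (use tenA_ident tenO_Obj in blast)

text \<open>Splitting \<open>\<chi>\<^sub>0 \<circ> \<chi>\<^sub>1 = \<phi> \<otimes> \<psi>\<close> starts at the target: \<open>\<chi>\<^sub>0\<close> splits along the targets of \<open>\<phi>\<close> and
  \<open>\<psi>\<close>, then \<open>\<chi>\<^sub>1\<close> along the sources of the two parts of \<open>\<chi>\<^sub>0\<close>, and uniqueness identifies the two
  composites with \<open>\<phi>\<close> and \<open>\<psi>\<close>.\<close>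

lemma factorizations_tensor:
  assumes \<phi>: "\<phi> \<in> Arr F" and \<psi>: "\<psi> \<in> Arr F"
  shows "bij_betw (\<lambda>(p, q). (tenA F (fst p) (fst q), tenA F (snd p) (snd q)))
           (factorizations F \<phi> \<times> factorizations F \<psi>) (factorizations F (tenA F \<phi> \<psi>))"
    (is "bij_betw ?t _ _")
  unfolding bij_betw_def
proof
  show "inj_on ?t (factorizations F \<phi> \<times> factorizations F \<psi>)"
  proof (rule inj_onI)
    fix x y
    assume xy: "x \<in> factorizations F \<phi> \<times> factorizations F \<psi>"
        "y \<in> factorizations F \<phi> \<times> factorizations F \<psi>"
      and t: "?t x = ?t y"
    obtain a b c d a' b' c' d' where x: "x = ((a, b), (c, d))" and y: "y = ((a', b'), (c', d'))"
      by (metis prod.exhaust)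
    have eq: "tenA F a c = tenA F a' c'" "tenA F b d = tenA F b' d'"
      using t x y by auto
    from xy x y have Arr: "a \<in> Arr F" "b \<in> Arr F" "c \<in> Arr F" "d \<in> Arr F"
        "a' \<in> Arr F" "b' \<in> Arr F" "c' \<in> Arr F" "d' \<in> Arr F"
      and ends: "src F a = tgt F b" "src F c = tgt F d" "src F a' = tgt F b'" "src F c' = tgt F d'"
      and "a \<cdot> b = \<phi>" "a' \<cdot> b' = \<phi>" "c \<cdot> d = \<psi>" "c' \<cdot> d' = \<psi>"
      by (auto simp: factorizations_def)
    then have "tgt F a = tgt F a'" "tgt F c = tgt F c'"
      using tgt_cmp by metis+
    then have "a = a' \<and> c = c'"
      using Arr eq(1) by (intro split_unique) auto
    moreover from this have "b = b' \<and> d = d'"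
      using Arr ends eq(2) by (intro split_unique) auto
    ultimately show "x = y" by (simp add: x y)
  qed
  show "?t ` (factorizations F \<phi> \<times> factorizations F \<psi>) = factorizations F (tenA F \<phi> \<psi>)"
  proof (rule equalityI; rule subsetI)
    fix x assume "x \<in> ?t ` (factorizations F \<phi> \<times> factorizations F \<psi>)"
    then show "x \<in> factorizations F (tenA F \<phi> \<psi>)"
      using interchange tenA_Arr src_tenA tgt_tenA by (auto simp: factorizations_def)
  next
    fix x assume "x \<in> factorizations F (tenA F \<phi> \<psi>)"
    then obtain \<chi>0 \<chi>1 where x: "x = (\<chi>0, \<chi>1)" and \<chi>: "\<chi>0 \<in> Arr F" "\<chi>1 \<in> Arr F"
      "src F \<chi>0 = tgt F \<chi>1" "tenA F \<phi> \<psi> = \<chi>0 \<cdot> \<chi>1"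
      by (auto simp: factorizations_def)
    have "tgt F \<chi>0 = tenO F (tgt F \<phi>) (tgt F \<psi>)"
      using tgt_cmp[OF \<chi>(2,1,3)] \<chi>(4) tgt_tenA[OF \<phi> \<psi>] by simp
    then obtain a c where ac: "a \<in> Arr F" "c \<in> Arr F" "tgt F a = tgt F \<phi>" "tgt F c = tgt F \<psi>"
      "\<chi>0 = tenA F a c"
      using split[OF \<chi>(1) tgt_Obj[OF \<phi>] tgt_Obj[OF \<psi>]] by blast
    have "tgt F \<chi>1 = tenO F (src F a) (src F c)"
      using \<chi>(3) src_tenA ac by simp
    then obtain b d where bd: "b \<in> Arr F" "d \<in> Arr F" "tgt F b = src F a" "tgt F d = src F c"
      "\<chi>1 = tenA F b d"
      using split[OF \<chi>(2) src_Obj src_Obj] ac by blast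
    have "tenA F \<phi> \<psi> = tenA F (a \<cdot> b) (c \<cdot> d)"
      using \<chi>(4) interchange ac bd by simp
    then have "\<phi> = a \<cdot> b \<and> \<psi> = c \<cdot> d"
      using \<phi> \<psi> ac bd cmp_Arr tgt_cmp by (intro split_unique) auto
    then show "x \<in> ?t ` (factorizations F \<phi> \<times> factorizations F \<psi>)"
      using x ac bd by (auto simp: factorizations_def intro!: image_eqI[of _ _ "((a, b), (c, d))"])
  qed
qed

end

text \<open>Both sets are in bijection with the decompositions \<open>\<phi> = a \<circ> b \<circ> c\<close> into three arrows.\<close>

lemma (in category) factorizations_assoc:
  "bij_betw (\<lambda>(p, q). ((fst q, snd q \<cdot> snd p), (snd q, snd p)))
     (SIGMA p:factorizations C \<phi>. factorizations C (fst p))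
     (SIGMA p:factorizations C \<phi>. factorizations C (snd p))"
  by (rule bij_betwI[where g = "\<lambda>(p, q). ((fst p \<cdot> fst q, snd q), (fst p, fst q))"])
    (auto simp: factorizations_def cmp_Arr src_cmp tgt_cmp cmp_assoc)

locale decomposition_finite_splitting_category = target_splitting_category F
  for F :: "('o, 'm) moncat" (structure) +
  assumes decomposition_finite: "decomposition_finite F"
begin

abbreviation "B \<equiv> mor_group F"
abbreviation "BB \<equiv> tensor B B"

lemma finite_factorizations: "\<phi> \<in> Arr F \<Longrightarrow> finite (factorizations F \<phi>)"
  using decomposition_finite by (simp add: decomposition_finite_def)

lemma factorizations_Arr:
  "p \<in> factorizations F \<phi> \<Longrightarrow> fst p \<in> Arr F" "p \<in> factorizations F \<phi> \<Longrightarrow> snd p \<in> Arr F"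
  by (auto simp: factorizations_def)

lemma comm_group_B: "comm_group B"
  unfolding mor_group_def by (rule abelian_free_Abelian_group)

lemmas comm_group_BB = comm_group_tensor[OF comm_group_B comm_group_B]

sublocale B: comm_group B by (rule comm_group_B)
sublocale BB: comm_group BB by (rule comm_group_BB)

lemma frag_closed [simp]: "\<phi> \<in> Arr F \<Longrightarrow> frag_of \<phi> \<in> carrier B"
  by (simp add: mor_group_def)

lemmas hom_eqI = free_Abelian_group_hom_eqI[where S = "Arr F", folded mor_group_def]
lemmas biadditive_eqI =
  free_Abelian_group_biadditive_eqI[where S = "Arr F" and T = "Arr F", folded mor_group_def]

abbreviation pure :: "'m \<Rightarrow> 'm \<Rightarrow> (('m \<Rightarrow>\<^sub>0 int) \<times> ('m \<Rightarrow>\<^sub>0 int) \<Rightarrow>\<^sub>0 int) set" where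
  "pure \<phi> \<psi> \<equiv> pure_tensor B B (frag_of \<phi>) (frag_of \<psi>)"

lemmas pure_tensor_BB = pure_tensor_biadditive[OF comm_group_B comm_group_B]

lemma pure_closed: "\<phi> \<in> Arr F \<Longrightarrow> \<psi> \<in> Arr F \<Longrightarrow> pure \<phi> \<psi> \<in> carrier BB"
  by (intro biadditive_closed[OF pure_tensor_BB] frag_closed)

lemma pure_factorizations_closed:
  "(\<lambda>p. pure (fst p) (snd p)) \<in> factorizations F \<phi> \<rightarrow> carrier BB"
  by (auto intro: pure_closed factorizations_Arr)

lemma mor_mult_biadditive: "biadditive B B B (mor_mult F)"
  unfolding mor_mult_def using tenA_Arr
  by (intro lin_ext_biadditive[where S = "Arr F" and T = "Arr F", folded mor_group_def] comm_group_B)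
    auto

lemma mor_mult_frag:
  "\<phi> \<in> Arr F \<Longrightarrow> \<psi> \<in> Arr F \<Longrightarrow> mor_mult F (frag_of \<phi>) (frag_of \<psi>) = frag_of (tenA F \<phi> \<psi>)"
  by (simp add: mor_mult_def lin_ext_frag_of[OF comm_group_B] tenA_Arr)

lemma mor_comult_hom: "mor_comult F \<in> hom B BB"
  unfolding mor_comult_def
  by (rule lin_ext_hom[where S = "Arr F", folded mor_group_def, OF comm_group_BB])
    (rule BB.finprod_closed[OF pure_factorizations_closed])

lemma mor_comult_frag:
  "mor_comult F (frag_of \<phi>) = (\<Otimes>\<^bsub>BB\<^esub>p \<in> factorizations F \<phi>. pure (fst p) (snd p))"
  unfolding mor_comult_def
  by (simp add: lin_ext_frag_of[OF comm_group_BB] BB.finprod_closed pure_factorizations_closed)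

lemma hom_mor_comult_frag:
  assumes "comm_group D" and "h \<in> hom BB D"
  shows "h (mor_comult F (frag_of \<phi>)) = (\<Otimes>\<^bsub>D\<^esub>p \<in> factorizations F \<phi>. h (pure (fst p) (snd p)))"
  unfolding mor_comult_frag
  by (rule hom_finprod[OF comm_group_BB assms pure_factorizations_closed])

lemma mor_counit_hom: "mor_counit F \<in> hom B integer_group"
  unfolding mor_counit_def
  by (rule lin_ext_hom[where S = "Arr F", folded mor_group_def, OF abelian_integer_group]) simp

lemma mor_counit_frag:
  "mor_counit F (frag_of \<phi>) = (if \<exists>X \<in> Obj F. \<phi> = ident F X then 1 else 0)"
  unfolding mor_counit_def by (rule lin_ext_frag_of[OF abelian_integer_group]) simp

lemma mor_unit_one: "mor_unit F 1 = frag_of (ident F (unitO F))"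
  using unit_Obj ident_Arr by (simp add: mor_unit_def B.int_pow_1)

lemma mor_mult_assoc:
  assumes a: "a \<in> carrier B" and b: "b \<in> carrier B" and c: "c \<in> carrier B"
  shows "mor_mult F (mor_mult F a b) c = mor_mult F a (mor_mult F b c)"
proof (rule biadditive_eqI[OF B.is_group _ _ _ a b,
      where \<beta> = "\<lambda>a b. mor_mult F (mor_mult F a b) c" and \<gamma> = "\<lambda>a b. mor_mult F a (mor_mult F b c)"])
  note m = mor_mult_biadditive
  show "biadditive B B B (\<lambda>a b. mor_mult F (mor_mult F a b) c)"
    by (rule biadditive_then_hom[OF m biadditive_left[OF m c]])
  show "biadditive B B B (\<lambda>a b. mor_mult F a (mor_mult F b c))"
    by (rule biadditive_comp[OF m hom_ident biadditive_left[OF m c]])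
  fix \<phi> \<psi> assume Arr: "\<phi> \<in> Arr F" "\<psi> \<in> Arr F"
  show "mor_mult F (mor_mult F (frag_of \<phi>) (frag_of \<psi>)) c
      = mor_mult F (frag_of \<phi>) (mor_mult F (frag_of \<psi>) c)"
    using Arr tenA_assoc tenA_Arr
    by (intro hom_eqI[OF B.is_group biadditive_right[OF m]
          hom_comp[OF biadditive_right[OF m] biadditive_right[OF m]] _ c])
      (simp_all add: mor_mult_frag)
qed

lemma int_algebra_mor: "int_algebra B (mor_mult F) (mor_unit F)"
proof
  note m = mor_mult_biadditive
  show "(\<lambda>a. mor_mult F a b) \<in> hom B B" if "b \<in> carrier B" for b
    by (rule biadditive_left[OF m that])
  show "(\<lambda>b. mor_mult F a b) \<in> hom B B" if "a \<in> carrier B" for a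
    by (rule biadditive_right[OF m that])
  show "mor_mult F (mor_mult F a b) c = mor_mult F a (mor_mult F b c)"
    if "a \<in> carrier B" "b \<in> carrier B" "c \<in> carrier B" for a b c
    using mor_mult_assoc that .
  have one: "ident F (unitO F) \<in> Arr F"
    using unit_Obj ident_Arr by blast
  have "mor_unit F = (\<lambda>n. frag_of (ident F (unitO F)) [^]\<^bsub>B\<^esub> n)"
    by (simp add: fun_eq_iff mor_unit_def)
  then show "mor_unit F \<in> hom integer_group B"
    using B.hom_integer_group_pow[OF frag_closed[OF one]] by simp
  show "mor_mult F (mor_unit F 1) a = a" if a: "a \<in> carrier B" for a
    unfolding mor_unit_one
    by (rule hom_eqI[OF B.is_group biadditive_right[OF m frag_closed[OF one]] hom_ident _ a])
      (simp add: mor_mult_frag one tenA_unit_left)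
  show "mor_mult F a (mor_unit F 1) = a" if a: "a \<in> carrier B" for a
    unfolding mor_unit_one
    by (rule hom_eqI[OF B.is_group biadditive_left[OF m frag_closed[OF one]] hom_ident _ a])
      (simp add: mor_mult_frag one tenA_unit_right)
qed

text \<open>For a generator \<open>\<phi>\<close>, both sides are sums of \<open>a \<otimes> (b \<otimes> c)\<close> over the decompositions
  \<open>\<phi> = a \<circ> b \<circ> c\<close>, which are reached by factoring the first or the second factor of \<open>\<phi>\<close> once
  more.\<close>

lemma mor_coassoc:
  assumes b: "b \<in> carrier B"
  shows "tensor_assoc B B B (tensor_map BB B (mor_comult F) (\<lambda>x. x) (mor_comult F b)) =
    tensor_map B BB (\<lambda>x. x) (mor_comult F) (mor_comult F b)"
proof -
  let ?T = "tensor B BB"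
  let ?l = "\<lambda>t. tensor_assoc B B B (tensor_map BB B (mor_comult F) (\<lambda>x. x) t)"
  let ?r = "tensor_map B BB (\<lambda>x. x) (mor_comult F)"
  let ?pure3 = "\<lambda>a b c. pure_tensor B BB (frag_of a) (pure b c)"
  note T = comm_group_tensor[OF comm_group_B comm_group_BB]
  interpret T: comm_group ?T by (rule T)
  have pure3_closed: "?pure3 a b c \<in> carrier ?T" if "a \<in> Arr F" "b \<in> Arr F" "c \<in> Arr F" for a b c
    using that by (intro biadditive_closed[OF pure_tensor_biadditive[OF comm_group_B comm_group_BB]]
        frag_closed pure_closed)
  have l: "?l \<in> hom BB ?T"
    by (rule hom_comp[OF tensor_map_hom[OF comm_group_B comm_group_B comm_group_BB comm_group_B
            mor_comult_hom hom_ident] tensor_assoc_hom[OF comm_group_B comm_group_B comm_group_B]])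
  have r: "?r \<in> hom BB ?T"
    by (rule tensor_map_hom[OF comm_group_B comm_group_B comm_group_B comm_group_BB
          hom_ident mor_comult_hom])
  have l_pure: "?l (pure \<phi>0 \<phi>1) = (\<Otimes>\<^bsub>?T\<^esub>q \<in> factorizations F \<phi>0. ?pure3 (fst q) (snd q) \<phi>1)"
    if "\<phi>0 \<in> Arr F" "\<phi>1 \<in> Arr F" for \<phi>0 \<phi>1
  proof -
    have "?l (pure \<phi>0 \<phi>1)
        = tensor_assoc B B B (pure_tensor BB B (mor_comult F (frag_of \<phi>0)) (frag_of \<phi>1))"
      using tensor_map_pure[OF comm_group_B comm_group_B comm_group_BB comm_group_B
          mor_comult_hom hom_ident] that by simp
    also have "\<dots> = (\<Otimes>\<^bsub>?T\<^esub>q \<in> factorizations F \<phi>0.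
        tensor_assoc B B B (pure_tensor BB B (pure (fst q) (snd q)) (frag_of \<phi>1)))"
      by (rule hom_mor_comult_frag[OF T hom_comp[OF
              biadditive_left[OF pure_tensor_biadditive[OF comm_group_BB comm_group_B]
                frag_closed[OF that(2)]]
              tensor_assoc_hom[OF comm_group_B comm_group_B comm_group_B]]])
    also have "\<dots> = (\<Otimes>\<^bsub>?T\<^esub>q \<in> factorizations F \<phi>0. ?pure3 (fst q) (snd q) \<phi>1)"
    proof (rule T.finprod_cong'[OF refl])
      show "(\<lambda>q. ?pure3 (fst q) (snd q) \<phi>1) \<in> factorizations F \<phi>0 \<rightarrow> carrier ?T"
        using that by (auto intro!: pure3_closed intro: factorizations_Arr)
    next
      fix q assume q: "q \<in> factorizations F \<phi>0"
      show "tensor_assoc B B B (pure_tensor BB B (pure (fst q) (snd q)) (frag_of \<phi>1))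
          = ?pure3 (fst q) (snd q) \<phi>1"
        by (intro tensor_assoc_pure comm_group_B frag_closed factorizations_Arr[OF q] that)
    qed
    finally show ?thesis .
  qed
  have r_pure: "?r (pure \<phi>0 \<phi>1) = (\<Otimes>\<^bsub>?T\<^esub>q \<in> factorizations F \<phi>1. ?pure3 \<phi>0 (fst q) (snd q))"
    if "\<phi>0 \<in> Arr F" "\<phi>1 \<in> Arr F" for \<phi>0 \<phi>1
  proof -
    have "?r (pure \<phi>0 \<phi>1) = pure_tensor B BB (frag_of \<phi>0) (mor_comult F (frag_of \<phi>1))"
      using tensor_map_pure[OF comm_group_B comm_group_B comm_group_B comm_group_BB
          hom_ident mor_comult_hom] that by simp
    also have "\<dots> = (\<Otimes>\<^bsub>?T\<^esub>q \<in> factorizations F \<phi>1. ?pure3 \<phi>0 (fst q) (snd q))"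
      by (rule hom_mor_comult_frag[OF T biadditive_right[OF
              pure_tensor_biadditive[OF comm_group_B comm_group_BB] frag_closed[OF that(1)]]])
    finally show ?thesis .
  qed
  show ?thesis
  proof (rule hom_eqI[OF T.is_group hom_comp[OF mor_comult_hom l] hom_comp[OF mor_comult_hom r] _ b])
    fix \<phi> assume \<phi>: "\<phi> \<in> Arr F"
    have "?l (mor_comult F (frag_of \<phi>)) = (\<Otimes>\<^bsub>?T\<^esub>p \<in> factorizations F \<phi>. ?l (pure (fst p) (snd p)))"
      by (rule hom_mor_comult_frag[OF T l])
    also have "\<dots> = (\<Otimes>\<^bsub>?T\<^esub>p \<in> factorizations F \<phi>. \<Otimes>\<^bsub>?T\<^esub>q \<in> factorizations F (fst p).
        ?pure3 (fst q) (snd q) (snd p))"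
      by (intro T.finprod_cong') (auto intro!: T.finprod_closed l_pure pure3_closed intro: factorizations_Arr)
    also have "\<dots> = (\<Otimes>\<^bsub>?T\<^esub>x \<in> (SIGMA p:factorizations F \<phi>. factorizations F (fst p)).
        ?pure3 (fst (snd x)) (snd (snd x)) (snd (fst x)))"
      using \<phi> by (intro T.finprod_Sigma finite_factorizations pure3_closed factorizations_Arr)
    also have "\<dots> = (\<Otimes>\<^bsub>?T\<^esub>x \<in> (SIGMA p:factorizations F \<phi>. factorizations F (snd p)).
        ?pure3 (fst (fst x)) (fst (snd x)) (snd (snd x)))"
    proof -
      let ?g = "\<lambda>x. ?pure3 (fst (fst x)) (fst (snd x)) (snd (snd x))"
      let ?f = "\<lambda>(p, q). ((fst q, snd q \<cdot> snd p), (snd q, snd p))"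
      let ?L = "SIGMA p:factorizations F \<phi>. factorizations F (fst p)"
      note bij = factorizations_assoc[of \<phi>]
      have "finprod ?T ?g (?f ` ?L) = (\<Otimes>\<^bsub>?T\<^esub>x \<in> ?L. ?g (?f x))"
        unfolding bij_betw_imp_surj_on[OF bij]
        by (rule T.finprod_reindex[OF _ bij_betw_imp_inj_on[OF bij],
              unfolded bij_betw_imp_surj_on[OF bij]])
          (auto intro!: pure3_closed dest: factorizations_Arr)
      then show ?thesis
        unfolding bij_betw_imp_surj_on[OF bij] by (simp add: case_prod_beta)
    qed
    also have "\<dots> = (\<Otimes>\<^bsub>?T\<^esub>p \<in> factorizations F \<phi>. \<Otimes>\<^bsub>?T\<^esub>q \<in> factorizations F (snd p).
        ?pure3 (fst p) (fst q) (snd q))"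
      using \<phi> by (intro T.finprod_Sigma[symmetric] finite_factorizations pure3_closed factorizations_Arr)
    also have "\<dots> = (\<Otimes>\<^bsub>?T\<^esub>p \<in> factorizations F \<phi>. ?r (pure (fst p) (snd p)))"
      by (intro T.finprod_cong')
        (auto intro!: r_pure[symmetric] hom_in_carrier[OF r] pure_closed intro: factorizations_Arr)
    also have "\<dots> = ?r (mor_comult F (frag_of \<phi>))"
      by (rule hom_mor_comult_frag[OF T r, symmetric])
    finally show "?l (mor_comult F (frag_of \<phi>)) = ?r (mor_comult F (frag_of \<phi>))" .
  qed
qed

text \<open>The counit keeps one summand of the coproduct, since \<open>\<phi> = id \<circ> \<phi>\<close> is the only
  factorization of \<open>\<phi>\<close> that begins with an identity.\<close>

lemma mor_counit_left:
  assumes b: "b \<in> carrier B"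
  shows "tensor_map integer_group B (mor_counit F) (\<lambda>x. x) (mor_comult F b)
    = pure_tensor integer_group B 1 b"
proof -
  let ?T = "tensor integer_group B"
  let ?h = "tensor_map integer_group B (mor_counit F) (\<lambda>x. x)"
  note T = comm_group_tensor[OF abelian_integer_group comm_group_B]
  note pure_T = pure_tensor_biadditive[OF abelian_integer_group comm_group_B]
  interpret T: comm_group ?T by (rule T)
  note maps = comm_group_B comm_group_B abelian_integer_group comm_group_B mor_counit_hom hom_ident
  have h: "?h \<in> hom BB ?T"
    by (rule tensor_map_hom[OF maps])
  have one: "(\<lambda>b. pure_tensor integer_group B 1 b) \<in> hom B ?T"
    by (rule biadditive_right[OF pure_T]) simp
  show ?thesis
  proof (rule hom_eqI[OF T.is_group hom_comp[OF mor_comult_hom h] one _ b])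
    fix \<phi> assume \<phi>: "\<phi> \<in> Arr F"
    let ?p = "(ident F (tgt F \<phi>), \<phi>)"
    have p: "?p \<in> factorizations F \<phi>"
      using \<phi> tgt_Obj ident_Arr src_ident cmp_ident_left by (auto simp: factorizations_def)
    have closed: "pure_tensor integer_group B 1 (frag_of \<phi>) \<in> carrier ?T"
      using hom_in_carrier[OF one] \<phi> by simp
    have summand: "?h (pure (fst q) (snd q)) =
        (if q = ?p then pure_tensor integer_group B 1 (frag_of \<phi>) else \<one>\<^bsub>?T\<^esub>)"
      if q: "q \<in> factorizations F \<phi>" for q
    proof -
      have Arr: "fst q \<in> Arr F" "snd q \<in> Arr F" "src F (fst q) = tgt F (snd q)" "\<phi> = fst q \<cdot> snd q"
        using q by (auto simp: factorizations_def)
      have ident: "(\<exists>X \<in> Obj F. fst q = ident F X) \<longleftrightarrow> q = ?p"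
      proof
        assume "\<exists>X \<in> Obj F. fst q = ident F X"
        then have "fst q = ident F (tgt F (snd q))"
          using Arr(3) src_ident by auto
        then show "q = ?p"
          using Arr cmp_ident_left[OF Arr(2)] by (simp add: prod_eq_iff)
      qed (use \<phi> tgt_Obj in auto)
      have "?h (pure (fst q) (snd q)) =
          pure_tensor integer_group B (mor_counit F (frag_of (fst q))) (frag_of (snd q))"
        using tensor_map_pure[OF maps] Arr by simp
      moreover have "pure_tensor integer_group B 0 (frag_of (snd q)) = \<one>\<^bsub>?T\<^esub>"
        using hom_one[OF biadditive_left[OF pure_T frag_closed[OF Arr(2)]]] T.is_group by simp
      ultimately show ?thesis
        using ident by (auto simp: mor_counit_frag)
    qed
    have "?h (mor_comult F (frag_of \<phi>)) = (\<Otimes>\<^bsub>?T\<^esub>q \<in> factorizations F \<phi>. ?h (pure (fst q) (snd q)))"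
      by (rule hom_mor_comult_frag[OF T h])
    also have "\<dots> = (\<Otimes>\<^bsub>?T\<^esub>q \<in> factorizations F \<phi>.
        if q = ?p then pure_tensor integer_group B 1 (frag_of \<phi>) else \<one>\<^bsub>?T\<^esub>)"
      using summand closed by (intro T.finprod_cong') auto
    also have "\<dots> = pure_tensor integer_group B 1 (frag_of \<phi>)"
      using p finite_factorizations[OF \<phi>] closed
        T.finprod_singleton_swap[of ?p "factorizations F \<phi>" "\<lambda>q. pure_tensor integer_group B 1 (frag_of \<phi>)"]
      by simp
    finally show "?h (mor_comult F (frag_of \<phi>)) = pure_tensor integer_group B 1 (frag_of \<phi>)" .
  qed
qed

text \<open>Here the summand kept is that of \<open>\<phi> = \<phi> \<circ> id\<close>.\<close>

lemma mor_counit_right: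
  assumes b: "b \<in> carrier B"
  shows "tensor_map B integer_group (\<lambda>x. x) (mor_counit F) (mor_comult F b)
    = pure_tensor B integer_group b 1"
proof -
  let ?T = "tensor B integer_group"
  let ?h = "tensor_map B integer_group (\<lambda>x. x) (mor_counit F)"
  note T = comm_group_tensor[OF comm_group_B abelian_integer_group]
  note pure_T = pure_tensor_biadditive[OF comm_group_B abelian_integer_group]
  interpret T: comm_group ?T by (rule T)
  note maps = comm_group_B comm_group_B comm_group_B abelian_integer_group hom_ident mor_counit_hom
  have h: "?h \<in> hom BB ?T"
    by (rule tensor_map_hom[OF maps])
  have one: "(\<lambda>b. pure_tensor B integer_group b 1) \<in> hom B ?T"
    by (rule biadditive_left[OF pure_T]) simp
  show ?thesis
  proof (rule hom_eqI[OF T.is_group hom_comp[OF mor_comult_hom h] one _ b])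
    fix \<phi> assume \<phi>: "\<phi> \<in> Arr F"
    let ?p = "(\<phi>, ident F (src F \<phi>))"
    have p: "?p \<in> factorizations F \<phi>"
      using \<phi> src_Obj ident_Arr tgt_ident cmp_ident_right by (auto simp: factorizations_def)
    have closed: "pure_tensor B integer_group (frag_of \<phi>) 1 \<in> carrier ?T"
      using hom_in_carrier[OF one] \<phi> by simp
    have summand: "?h (pure (fst q) (snd q)) =
        (if q = ?p then pure_tensor B integer_group (frag_of \<phi>) 1 else \<one>\<^bsub>?T\<^esub>)"
      if q: "q \<in> factorizations F \<phi>" for q
    proof -
      have Arr: "fst q \<in> Arr F" "snd q \<in> Arr F" "src F (fst q) = tgt F (snd q)" "\<phi> = fst q \<cdot> snd q"
        using q by (auto simp: factorizations_def)
      have ident: "(\<exists>X \<in> Obj F. snd q = ident F X) \<longleftrightarrow> q = ?p"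
      proof
        assume "\<exists>X \<in> Obj F. snd q = ident F X"
        then have "snd q = ident F (src F (fst q))"
          using Arr(3) tgt_ident by auto
        then show "q = ?p"
          using Arr cmp_ident_right[OF Arr(1)] by (simp add: prod_eq_iff)
      qed (use \<phi> src_Obj in auto)
      have "?h (pure (fst q) (snd q)) =
          pure_tensor B integer_group (frag_of (fst q)) (mor_counit F (frag_of (snd q)))"
        using tensor_map_pure[OF maps] Arr by simp
      moreover have "pure_tensor B integer_group (frag_of (fst q)) 0 = \<one>\<^bsub>?T\<^esub>"
        using hom_one[OF biadditive_right[OF pure_T frag_closed[OF Arr(1)]]] T.is_group by simp
      ultimately show ?thesis
        using ident by (auto simp: mor_counit_frag)
    qed
    have "?h (mor_comult F (frag_of \<phi>)) = (\<Otimes>\<^bsub>?T\<^esub>q \<in> factorizations F \<phi>. ?h (pure (fst q) (snd q)))"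
      by (rule hom_mor_comult_frag[OF T h])
    also have "\<dots> = (\<Otimes>\<^bsub>?T\<^esub>q \<in> factorizations F \<phi>.
        if q = ?p then pure_tensor B integer_group (frag_of \<phi>) 1 else \<one>\<^bsub>?T\<^esub>)"
      using summand closed by (intro T.finprod_cong') auto
    also have "\<dots> = pure_tensor B integer_group (frag_of \<phi>) 1"
      using p finite_factorizations[OF \<phi>] closed
        T.finprod_singleton_swap[of ?p "factorizations F \<phi>" "\<lambda>q. pure_tensor B integer_group (frag_of \<phi>) 1"]
      by simp
    finally show "?h (mor_comult F (frag_of \<phi>)) = pure_tensor B integer_group (frag_of \<phi>) 1" .
  qed
qed

text \<open>For generators \<open>\<phi>\<close> and \<open>\<psi>\<close>, the product of the coproducts is a sum over pairs of
  factorizations, and the summand of a pair is the pure tensor of the corresponding factorization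
  of \<open>\<phi> \<otimes> \<psi>\<close>.\<close>

lemma mor_comult_mult:
  assumes a: "a \<in> carrier B" and b: "b \<in> carrier B"
  shows "mor_comult F (mor_mult F a b)
    = tensor_mult B (mor_mult F) (mor_comult F a) (mor_comult F b)"
proof (rule biadditive_eqI[OF BB.is_group _ _ _ a b,
      where \<beta> = "\<lambda>a b. mor_comult F (mor_mult F a b)"
        and \<gamma> = "\<lambda>a b. tensor_mult B (mor_mult F) (mor_comult F a) (mor_comult F b)"])
  note tm = tensor_mult_biadditive[OF comm_group_B mor_mult_biadditive]
  note tm_pure = tensor_mult_pure[OF comm_group_B mor_mult_biadditive]
  let ?m = "tensor_mult B (mor_mult F)"
  show "biadditive B B BB (\<lambda>a b. mor_comult F (mor_mult F a b))"
    by (rule biadditive_then_hom[OF mor_mult_biadditive mor_comult_hom])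
  show "biadditive B B BB (\<lambda>a b. ?m (mor_comult F a) (mor_comult F b))"
    by (rule biadditive_comp[OF tm mor_comult_hom mor_comult_hom])
  fix \<phi> \<psi> assume \<phi>: "\<phi> \<in> Arr F" and \<psi>: "\<psi> \<in> Arr F"
  let ?pure2 = "\<lambda>p q. pure (tenA F (fst p) (fst q)) (tenA F (snd p) (snd q))"
  have closed: "?pure2 p q \<in> carrier BB"
    if "p \<in> factorizations F \<phi>" "q \<in> factorizations F \<psi>" for p q
    using that by (intro pure_closed tenA_Arr factorizations_Arr)
  have \<Delta>\<psi>: "mor_comult F (frag_of \<psi>) \<in> carrier BB"
    using hom_in_carrier[OF mor_comult_hom] \<psi> by simp
  have "?m (mor_comult F (frag_of \<phi>)) (mor_comult F (frag_of \<psi>))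
      = (\<Otimes>\<^bsub>BB\<^esub>p \<in> factorizations F \<phi>. ?m (pure (fst p) (snd p)) (mor_comult F (frag_of \<psi>)))"
    by (rule hom_mor_comult_frag[OF comm_group_BB biadditive_left[OF tm \<Delta>\<psi>]])
  also have "\<dots> = (\<Otimes>\<^bsub>BB\<^esub>p \<in> factorizations F \<phi>. \<Otimes>\<^bsub>BB\<^esub>q \<in> factorizations F \<psi>. ?pure2 p q)"
  proof (rule BB.finprod_cong'[OF refl])
    show "(\<lambda>p. \<Otimes>\<^bsub>BB\<^esub>q \<in> factorizations F \<psi>. ?pure2 p q) \<in> factorizations F \<phi> \<rightarrow> carrier BB"
      using closed by auto
    fix p assume p: "p \<in> factorizations F \<phi>"
    have "?m (pure (fst p) (snd p)) (mor_comult F (frag_of \<psi>))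
        = (\<Otimes>\<^bsub>BB\<^esub>q \<in> factorizations F \<psi>. ?m (pure (fst p) (snd p)) (pure (fst q) (snd q)))"
      by (rule hom_mor_comult_frag[OF comm_group_BB biadditive_right[OF tm]])
        (intro pure_closed factorizations_Arr[OF p])
    also have "\<dots> = (\<Otimes>\<^bsub>BB\<^esub>q \<in> factorizations F \<psi>. ?pure2 p q)"
      using closed[OF p] factorizations_Arr[OF p]
      by (intro BB.finprod_cong') (auto simp: tm_pure mor_mult_frag factorizations_Arr)
    finally show "?m (pure (fst p) (snd p)) (mor_comult F (frag_of \<psi>))
        = (\<Otimes>\<^bsub>BB\<^esub>q \<in> factorizations F \<psi>. ?pure2 p q)" .
  qed
  also have "\<dots> = (\<Otimes>\<^bsub>BB\<^esub>x \<in> factorizations F \<phi> \<times> factorizations F \<psi>. ?pure2 (fst x) (snd x))"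
    using \<phi> \<psi> by (intro BB.finprod_Sigma finite_factorizations closed)
  also have "\<dots> = (\<Otimes>\<^bsub>BB\<^esub>p \<in> factorizations F (tenA F \<phi> \<psi>). pure (fst p) (snd p))"
  proof -
    let ?t = "\<lambda>(p, q). (tenA F (fst p) (fst q), tenA F (snd p) (snd q))"
    let ?P = "factorizations F \<phi> \<times> factorizations F \<psi>"
    note bij = factorizations_tensor[OF \<phi> \<psi>]
    have "(\<Otimes>\<^bsub>BB\<^esub>p \<in> ?t ` ?P. pure (fst p) (snd p))
        = (\<Otimes>\<^bsub>BB\<^esub>x \<in> ?P. pure (fst (?t x)) (snd (?t x)))"
      unfolding bij_betw_imp_surj_on[OF bij]
      by (rule BB.finprod_reindex[OF _ bij_betw_imp_inj_on[OF bij],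
            unfolded bij_betw_imp_surj_on[OF bij]])
        (rule pure_factorizations_closed)
    then show ?thesis
      unfolding bij_betw_imp_surj_on[OF bij] by (simp add: case_prod_beta)
  qed
  also have "\<dots> = mor_comult F (mor_mult F (frag_of \<phi>) (frag_of \<psi>))"
    by (simp add: mor_mult_frag \<phi> \<psi> mor_comult_frag)
  finally show "mor_comult F (mor_mult F (frag_of \<phi>) (frag_of \<psi>))
      = ?m (mor_comult F (frag_of \<phi>)) (mor_comult F (frag_of \<psi>))" ..
qed

lemma mor_counit_mult:
  assumes a: "a \<in> carrier B" and b: "b \<in> carrier B"
  shows "mor_counit F (mor_mult F a b) = mor_counit F a * mor_counit F b"
proof (rule biadditive_eqI[OF group_integer_group _ _ _ a b,
      where \<beta> = "\<lambda>a b. mor_counit F (mor_mult F a b)" and \<gamma> = "\<lambda>a b. mor_counit F a * mor_counit F b"])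
  have times: "biadditive integer_group integer_group integer_group (*)"
    by (rule biadditiveI) (auto simp: hom_def algebra_simps)
  show "biadditive B B integer_group (\<lambda>a b. mor_counit F (mor_mult F a b))"
    by (rule biadditive_then_hom[OF mor_mult_biadditive mor_counit_hom])
  show "biadditive B B integer_group (\<lambda>a b. mor_counit F a * mor_counit F b)"
    by (rule biadditive_comp[OF times mor_counit_hom mor_counit_hom])
  fix \<phi> \<psi> assume "\<phi> \<in> Arr F" "\<psi> \<in> Arr F"
  then show "mor_counit F (mor_mult F (frag_of \<phi>) (frag_of \<psi>))
      = mor_counit F (frag_of \<phi>) * mor_counit F (frag_of \<psi>)"
    by (simp add: mor_mult_frag mor_counit_frag ident_tensor_iff)
qed

theorem int_bialgebra_mor:
  "int_bialgebra B (mor_mult F) (mor_unit F) (mor_comult F) (mor_counit F)"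
proof -
  have "int_coalgebra B (mor_comult F) (mor_counit F)"
    by unfold_locales
      (rule mor_comult_hom mor_counit_hom mor_coassoc mor_counit_left mor_counit_right; assumption?)+
  moreover have "mor_comult F (mor_unit F 1) = pure_tensor B B (mor_unit F 1) (mor_unit F 1)"
    using unit_Obj ident_Arr
    by (simp add: mor_unit_one mor_comult_frag factorizations_unit BB.finprod_insert pure_closed)
  moreover have "mor_counit F (mor_unit F 1) = 1"
    using unit_Obj by (auto simp: mor_unit_one mor_counit_frag)
  ultimately show ?thesis
    using int_algebra_mor mor_comult_mult mor_counit_mult
    by (auto simp: int_bialgebra_def int_bialgebra_axioms_def)
qed

end

theorem theorem1p20:
  fixes V :: "('o, 'm) cat" and F :: "('o, 'm) moncat" and \<iota> :: "('o, 'm, 'o, 'm) fctr"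
  assumes "strict_nonsigma_feynman_category TYPE('u) V F \<iota>"
    and "decomposition_finite F"
  shows "int_bialgebra (mor_group F) (mor_mult F) (mor_unit F) (mor_comult F) (mor_counit F)"
proof -
  interpret strict_feynman_category V F \<iota> "TYPE('u)"
    by (rule strict_feynman_category.intro[OF assms(1)])
  interpret decomposition_finite_splitting_category F
    by unfold_locales (rule assms(2))
  show ?thesis
    by (rule int_bialgebra_mor)
qed

end
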